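(* Let $P\subset\mathbb{R}^3$ be a 3-dimensional lattice polytope without interior lattice points. Then either $P$ is a Cayley polytope, or $P$ can be projected to the double unimodular 2-simplex $2\Delta_2$, or $P$ is an exceptional polytope, where up to affine unimodular transformation there are only finitely many exceptional polytopes. In other words: up to affine unimodular transformation of $\mathbb{R}^3$, there are only finitely many 3-dimensional lattice polytopes $P\subset\mathbb{R}^3$ with $P^\circ\cap\mathbb{Z}^3=\emptyset$ that are neither Cayley polytopes nor can be projected to $2\Delta_2$.
   Context: The lattice is $\mathbb{Z}^n\subset\mathbb{R}^n$; a lattice polytope is a polytope whose vertices all lie in $\mathbb{Z}^n$. $P^\circ$ denotes the interior of $P$. An affine unimodular transformation is a map $x\mapsto Ax+b$ with $A\in GL_n(\mathbb{Z})$, $b\in\mathbb{Z}^n$; $P\cong Q$ means that $P$ and $Q$ are equivalent under such a transformation. With $e_1,\dots,e_n$ the standard basis, $\Delta_n=\mathrm{conv}(0,e_1,\dots,e_n)$ is the unimodular $n$-simplex, and $2\Delta_2=\mathrm{conv}(0,2e_1,2e_2)\subset\mathbb{R}^2$. An $n$-dimensional lattice polytope $P\subset\mathbb{R}^n$ is a Cayley polytope if there are $1<r\le n$ and lattice polytopes $P_0,\dots,P_{r-1}$ in the linear span $\langle e_r,\dots,e_n\rangle$ such that $P\cong\mathrm{conv}(0\times P_0,\,e_1\times P_1,\dots,e_{r-1}\times P_{r-1})$ (where $e_i\times P_i$ means $e_i+P_i$); equivalently, $P$ can be projected to $\Delta_1=[0,1]$. "$P\subset\mathbb{R}^n$ can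 be projected to a lattice polytope $Q\subset\mathbb{R}^m$" means that there is an affine map $\mathbb{R}^n\to\mathbb{R}^m$ which maps $\mathbb{Z}^n$ onto $\mathbb{Z}^m$ and maps $P$ onto $Q$. *)

theory Defs
  imports "HOL-Analysis.Analysis"
begin

definition integer_lattice :: "(real^'n) set"
  where "integer_lattice = {x. \<forall>i. x $ i \<in> \<int>}"

text \<open>Nonemptiness is part of the definition: the library counts the empty set as a polytope.\<close>

definition lattice_polytope :: "(real^'n) set \<Rightarrow> bool"
  where "lattice_polytope P \<longleftrightarrow>
    polytope P \<and> P \<noteq> {} \<and> {v. v extreme_point_of P} \<subseteq> integer_lattice"

text \<open>An element of the general linear group over the integers is an integer matrix that
  is \<^const>\<open>invertible\<close> over the integers.\<close>

definition affine_unimodular :: "(real^'n \<Rightarrow> real^'n) \<Rightarrow> bool"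
  where "affine_unimodular f \<longleftrightarrow>
    (\<exists>(A::int^'n^'n) (b::real^'n). invertible A \<and> b \<in> integer_lattice \<and>
       f = (\<lambda>x. map_matrix real_of_int A *v x + b))"

definition unimodular_equiv :: "(real^'n) set \<Rightarrow> (real^'n) set \<Rightarrow> bool"  (infix "\<cong>\<^sub>\<int>" 50)
  where "P \<cong>\<^sub>\<int> Q \<longleftrightarrow> (\<exists>f. affine_unimodular f \<and> f ` P = Q)"

text \<open>The standard basis vectors, numbered from 1. The intended index types are the numeral
  types, on which \<^const>\<open>of_nat\<close> is a bijection from the numbers from 1 to \<open>CARD('n)\<close>
  (the last index being represented by 0).\<close>

definition std_basis :: "nat \<Rightarrow> real^'n::{finite,comm_ring_1}"
  where "std_basis i = axis (of_nat i) 1"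

lemma std_basis_range_3: "(std_basis :: nat \<Rightarrow> real^3) ` {1..3} = Basis"
  and inj_on_std_basis_3: "inj_on (std_basis :: nat \<Rightarrow> real^3) {1..3}"
proof -
  have I: "{1..3::nat} = {1, 2, 3}" by auto
  have B: "(Basis :: (real^3) set) = {axis 1 1, axis 2 1, axis 3 1}"
    by (auto simp: Basis_vec_def UNIV_3)
  show "(std_basis :: nat \<Rightarrow> real^3) ` {1..3} = Basis"
    unfolding I B by (simp add: std_basis_def)
  show "inj_on (std_basis :: nat \<Rightarrow> real^3) {1..3}"
    unfolding I by (simp add: std_basis_def axis_eq_axis)
qed

definition cayley_polytope :: "(real^'n::{finite,comm_ring_1}) set \<Rightarrow> bool"
  where "cayley_polytope P \<longleftrightarrow>
    (\<exists>r F. 1 < r \<and> r \<le> CARD('n) \<and>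
       (\<forall>i<r. lattice_polytope (F i) \<and> F i \<subseteq> span (std_basis ` {r..CARD('n)})) \<and>
       P \<cong>\<^sub>\<int> convex hull (F 0 \<union> (\<Union>i\<in>{1..<r}. (+) (std_basis i) ` F i)))"

definition double_unimodular_2_simplex :: "(real^2) set"
  where "double_unimodular_2_simplex =
    convex hull {0, 2 *\<^sub>R std_basis 1, 2 *\<^sub>R std_basis 2}"

definition projects_to :: "(real^'n) set \<Rightarrow> (real^'m) set \<Rightarrow> bool"
  where "projects_to P Q \<longleftrightarrow>
    (\<exists>f :: real^'n \<Rightarrow> real^'m. (\<exists>g c. linear g \<and> f = (\<lambda>x. g x + c)) \<and>
       f ` integer_lattice = integer_lattice \<and> f ` P = Q)"

lemma integer_mat_vec:
  "x \<in> integer_lattice \<Longrightarrow> map_matrix real_of_int A *v x \<in> integer_lattice"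
  by (auto simp: integer_lattice_def matrix_vector_mult_def intro!: Ints_sum Ints_mult)

lemma map_matrix_of_int_mult:
  "map_matrix real_of_int (A ** B) = map_matrix real_of_int A ** map_matrix real_of_int B"
  by (simp add: map_matrix_def matrix_matrix_mult_def vec_eq_iff)

lemma map_matrix_of_int_one: "map_matrix real_of_int (mat 1) = mat 1"
  by (simp add: map_matrix_def mat_def vec_eq_iff)

lemma equiv_unimodular: "equiv UNIV {(P :: (real^'n) set, Q). P \<cong>\<^sub>\<int> Q}"
proof (rule equivI)
  have id: "affine_unimodular (\<lambda>x :: real^'n. x)"
    unfolding affine_unimodular_def
    by (rule exI[of _ "mat 1"], rule exI[of _ 0])
       (auto simp: map_matrix_of_int_one integer_lattice_def invertible_def
             intro!: exI[of _ "mat 1"])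
  show "refl_on UNIV {(P :: (real^'n) set, Q). P \<cong>\<^sub>\<int> Q}"
    unfolding refl_on_def unimodular_equiv_def using id by force
next
  show "sym {(P :: (real^'n) set, Q). P \<cong>\<^sub>\<int> Q}"
  proof (rule symI, clarsimp simp: unimodular_equiv_def)
    fix P :: "(real^'n) set" and f :: "real^'n \<Rightarrow> real^'n"
    assume "affine_unimodular f"
    then obtain A b where "invertible (A :: int^'n^'n)" and b: "b \<in> integer_lattice"
      and f: "f = (\<lambda>x. map_matrix real_of_int A *v x + b)"
      by (auto simp: affine_unimodular_def)
    then obtain B where B: "A ** B = mat 1" "B ** A = mat 1"
      by (auto simp: invertible_def)
    define g where "g = (\<lambda>x. map_matrix real_of_int B *v x + - (map_matrix real_of_int B *v b))"
    have "invertible B" using B by (auto simp: invertible_def)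
    moreover have "- (map_matrix real_of_int B *v b) \<in> integer_lattice"
      using integer_mat_vec[OF b] by (auto simp: integer_lattice_def)
    ultimately have "affine_unimodular g"
      unfolding affine_unimodular_def g_def by blast
    moreover have "g (f x) = x" for x
      by (simp add: f g_def matrix_vector_right_distrib matrix_vector_mul_assoc
          map_matrix_of_int_mult[symmetric] B map_matrix_of_int_one)
    ultimately show "\<exists>g. affine_unimodular g \<and> g ` f ` P = P"
      by (intro exI[of _ g]) (auto simp: image_image)
  qed
next
  show "trans {(P :: (real^'n) set, Q). P \<cong>\<^sub>\<int> Q}"
  proof (rule transI, clarsimp simp: unimodular_equiv_def)
    fix P :: "(real^'n) set" and f h :: "real^'n \<Rightarrow> real^'n"
    assume "affine_unimodular f" "affine_unimodular h"
    then obtain A b C d where inv: "invertible (A :: int^'n^'n)" "invertible (C :: int^'n^'n)"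
      and b: "b \<in> integer_lattice" "d \<in> integer_lattice"
      and f: "f = (\<lambda>x. map_matrix real_of_int A *v x + b)"
        "h = (\<lambda>x. map_matrix real_of_int C *v x + d)"
      by (auto simp: affine_unimodular_def)
    have "invertible (C ** A)" using inv by (simp add: invertible_mult)
    moreover have "map_matrix real_of_int C *v b + d \<in> integer_lattice"
      using integer_mat_vec[OF b(1), of C] b(2) by (auto simp: integer_lattice_def)
    moreover have "h \<circ> f = (\<lambda>x. map_matrix real_of_int (C ** A) *v x +
        (map_matrix real_of_int C *v b + d))"
      by (auto simp: f matrix_vector_right_distrib matrix_vector_mul_assoc map_matrix_of_int_mult)
    ultimately have "affine_unimodular (h \<circ> f)"
      unfolding affine_unimodular_def by blast
    then show "\<exists>k. affine_unimodular k \<and> k ` P = h ` f ` P"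
      by (metis image_comp)
  qed
qed auto

end

theory Submission
  imports Defs
begin

text \<open>Let \<open>P\<close> be a lattice polytope and \<open>N\<close> large. If no segment \<open>[x, x + N v]\<close> with a nonzero
  lattice vector \<open>v\<close> fits into \<open>P\<close>, take a simplex of maximal determinant spanned by points of \<open>P\<close>. By the
  pigeonhole principle the multiples of every lattice vector hit the sublattice generated by its edges
  early, so with respect to these edges the lattice has bounded denominators. In these coordinates
  the points of \<open>P\<close> lie in \<open>[-1, 1]\<^sup>n\<close>, whence finitely many classes.

  Otherwise, project a three-dimensional \<open>P\<close> along \<open>v\<close> to a polygon \<open>Q\<close>. If \<open>Q\<close> has lattice width one, \<open>P\<close> is
  Cayley. If \<open>Q\<close> is \<open>2\<Delta>\<^sub>2\<close>, there is nothing to do. In all other cases \<open>Q\<close> contains a lattice point \<open>w\<close> that is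
  deep: for every \<open>x \<in> Q\<close> one has \<open>w = t x + (1 - t) y\<close> with some \<open>y \<in> Q\<close> and \<open>t \<ge> c\<close>, for an
  absolute constant \<open>c\<close>. Then the fibre of \<open>P\<close> over \<open>w\<close> has length at least \<open>c N > 1\<close>
  and contains an interior lattice point of \<open>P\<close>.

  The constant \<open>c\<close> comes from the same dichotomy in the plane: finitely many classes of polygons, each
  with an interior lattice point, or a projection to a segment.\<close>

subsection \<open>Lattice automorphisms\<close>

lemma integer_lattice_add: "x \<in> integer_lattice \<Longrightarrow> y \<in> integer_lattice \<Longrightarrow> x + y \<in> integer_lattice"
  and integer_lattice_diff: "x \<in> integer_lattice \<Longrightarrow> y \<in> integer_lattice \<Longrightarrow> x - y \<in> integer_lattice"
  and integer_lattice_uminus: "x \<in> integer_lattice \<Longrightarrow> - x \<in> integer_lattice"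
  and integer_lattice_scaleR: "c \<in> \<int> \<Longrightarrow> x \<in> integer_lattice \<Longrightarrow> c *\<^sub>R x \<in> integer_lattice"
  and integer_lattice_0: "0 \<in> integer_lattice"
  and integer_lattice_axis: "c \<in> \<int> \<Longrightarrow> axis i c \<in> integer_lattice"
  by (auto simp: integer_lattice_def axis_def)

lemma integer_lattice_sum: "(\<And>i. i \<in> I \<Longrightarrow> f i \<in> integer_lattice) \<Longrightarrow> sum f I \<in> integer_lattice"
  by (induction I rule: infinite_finite_induct) (auto simp: integer_lattice_0 integer_lattice_add)

lemmas integer_lattice_intros = integer_lattice_add integer_lattice_diff integer_lattice_uminus
  integer_lattice_scaleR integer_lattice_0 integer_lattice_axis integer_lattice_sum

text \<open>A matrix-free form of the linear part of an \<open>affine_unimodular\<close> map: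
  mapping the lattice onto itself replaces the integral inverse matrix.
  \<open>unimodular_equivI\<close> and \<open>affine_unimodularE\<close> translate between the
  two.\<close>

definition lattice_aut :: "(real^'n \<Rightarrow> real^'n) \<Rightarrow> bool"
  where "lattice_aut g \<longleftrightarrow> linear g \<and> bij g \<and> g ` integer_lattice = integer_lattice"

lemma lattice_autD:
  assumes "lattice_aut g"
  shows "linear g" "bij g" "inj g" "surj g" "g ` integer_lattice = integer_lattice"
    "\<And>x. x \<in> integer_lattice \<Longrightarrow> g x \<in> integer_lattice"
  using assms by (auto simp: lattice_aut_def bij_def)

lemma lattice_aut_comp: "lattice_aut g \<Longrightarrow> lattice_aut h \<Longrightarrow> lattice_aut (g \<circ> h)"
  unfolding lattice_aut_def by (metis linear_compose bij_comp image_comp)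

lemma lattice_aut_inv:
  assumes "lattice_aut g"
  shows "lattice_aut (inv g)"
proof -
  have "inv g ` integer_lattice = inv g ` g ` integer_lattice"
    using lattice_autD(5)[OF assms] by simp
  also have "\<dots> = integer_lattice"
    using lattice_autD(3)[OF assms] by (rule image_inv_f_f)
  finally show ?thesis
    using assms lattice_autD[OF assms] unfolding lattice_aut_def
    by (simp add: bij_imp_bij_inv inj_linear_imp_inv_linear)
qed

lemma lattice_autI:
  assumes "linear g" "\<And>x. h (g x) = x" "\<And>x. g (h x) = x"
    "\<And>x. x \<in> integer_lattice \<Longrightarrow> g x \<in> integer_lattice"
    "\<And>x. x \<in> integer_lattice \<Longrightarrow> h x \<in> integer_lattice"
  shows "lattice_aut g"
proof -
  have "bij g" by (rule o_bij[of h]) (use assms in \<open>auto simp: o_def\<close>)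
  moreover have "x \<in> g ` integer_lattice" if "x \<in> integer_lattice" for x
    using assms(3)[of x] assms(5)[OF that] by (metis image_eqI)
  ultimately show ?thesis
    using assms(1,4) by (auto simp: lattice_aut_def)
qed

text \<open>As \<open>f e = 0\<close>, the shear does not change the value of \<open>f\<close>, so
  subtracting the same multiple of \<open>e\<close> undoes it.\<close>

lemma lattice_aut_transvection:
  assumes "linear f" "\<And>x. x \<in> integer_lattice \<Longrightarrow> f x \<in> \<int>" "e \<in> integer_lattice" "f e = 0"
  shows "lattice_aut (\<lambda>x. x + f x *\<^sub>R e)"
proof (rule lattice_autI[of _ "\<lambda>x. x - f x *\<^sub>R e"])
  have l: "f (x + y) = f x + f y" "f (x - y) = f x - f y" "f (c *\<^sub>R x) = c * f x" for x y c
    using assms(1) by (auto simp: linear_add linear_diff linear_scale)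
  show "linear (\<lambda>x. x + f x *\<^sub>R e)"
    by (rule linearI) (auto simp: l algebra_simps)
qed (use assms in \<open>auto simp: linear_add linear_diff linear_scale intro!: integer_lattice_intros\<close>)

lemma lattice_aut_uminus: "lattice_aut uminus"
  by (rule lattice_autI[of _ uminus])
    (auto simp: module_hom_uminus linear_uminus intro!: integer_lattice_intros)

lemma lattice_aut_permute:
  assumes "bij \<pi>"
  shows "lattice_aut (\<lambda>x :: real^'n. \<chi> i. x $ \<pi> i)"
proof (rule lattice_autI[of _ "\<lambda>x. \<chi> i. x $ inv \<pi> i"])
  show "linear (\<lambda>x :: real^'n. \<chi> i. x $ \<pi> i)"
    by (rule linearI) (auto simp: vec_eq_iff)
qed (use assms in \<open>auto simp: integer_lattice_def vec_eq_iff bij_is_surj bij_is_inj surj_f_inv_f\<close>)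

text \<open>Euclid's algorithm on the coordinates: as long as two of them are nonzero, a shear
  reduces the larger by the smaller, which lowers the sum of absolute values by at least one. A
  single nonzero coordinate is moved to position \<open>k\<close> by a transposition and made
  positive by negation. The factor \<open>r\<close> is the gcd of the coordinates; it is 1 only for
  primitive \<open>v\<close>.\<close>

lemma lattice_aut_to_axis:
  fixes v :: "real^'n"
  assumes "v \<in> integer_lattice" "v \<noteq> 0"
  obtains g r where "lattice_aut g" "r \<in> \<int>" "r > 0" "g v = r *\<^sub>R axis k 1"
proof -
  have "\<exists>g r. lattice_aut g \<and> r \<in> \<int> \<and> r > 0 \<and> g v = r *\<^sub>R axis k 1"
    using assms
  proof (induction "nat \<lfloor>\<Sum>i\<in>UNIV. \<bar>v $ i\<bar>\<rfloor>" arbitrary: v rule: less_induct)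
    case less
    have vi: "v $ i \<in> \<int>" for i using less.prems by (auto simp: integer_lattice_def)
    obtain i where i: "v $ i \<noteq> 0" using less.prems(2) by (auto simp: vec_eq_iff)
    show ?case
    proof (cases "\<exists>j. j \<noteq> i \<and> v $ j \<noteq> 0")
      case True
      then obtain j where j: "j \<noteq> i" "v $ j \<noteq> 0" by blast
      obtain a b where ab: "a \<noteq> b" "v $ a \<noteq> 0" "v $ b \<noteq> 0" "\<bar>v $ a\<bar> \<ge> \<bar>v $ b\<bar>"
        using that[of i j] that[of j i] i j by (metis linear)
      \<comment> \<open>With this sign the absolute value of coordinate \<open>a\<close> drops by
        that of coordinate \<open>b\<close>, whatever the signs of the two.\<close>
      define c where "c = - (sgn (v $ a) * sgn (v $ b))"
      define g where "g = (\<lambda>x :: real^'n. x + (c * x $ b) *\<^sub>R axis a 1)"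
      have c: "c \<in> \<int>" by (auto simp: c_def sgn_if)
      have g: "lattice_aut g" unfolding g_def
        by (rule lattice_aut_transvection)
          (use ab(1) c in \<open>auto simp: integer_lattice_def axis_def linear_iff algebra_simps\<close>)
      have ga: "\<bar>g v $ a\<bar> = \<bar>v $ a\<bar> - \<bar>v $ b\<bar>"
      proof -
        have "g v $ a = sgn (v $ a) * (\<bar>v $ a\<bar> - \<bar>v $ b\<bar>)"
          using sgn_mult_abs[of "v $ a"] sgn_mult_abs[of "v $ b"] abs_sgn[of "v $ b"]
          by (simp add: g_def c_def algebra_simps axis_def)
        then show ?thesis using ab by (simp add: abs_mult abs_sgn_eq)
      qed
      have gj: "g v $ j = v $ j" if "j \<noteq> a" for j
        using that by (auto simp: g_def axis_def)
      have gv: "g v \<in> integer_lattice" using less.prems(1) lattice_autD(6)[OF g] by blast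
      have gv0: "g v \<noteq> 0" using gj[of b] ab by (metis zero_index)
      have "(\<Sum>i\<in>UNIV. \<bar>g v $ i\<bar>) = \<bar>g v $ a\<bar> + (\<Sum>i\<in>UNIV - {a}. \<bar>g v $ i\<bar>)"
        by (simp add: sum.remove)
      also have "(\<Sum>i\<in>UNIV - {a}. \<bar>g v $ i\<bar>) = (\<Sum>i\<in>UNIV - {a}. \<bar>v $ i\<bar>)"
        by (intro sum.cong) (auto simp: gj)
      finally have s: "(\<Sum>i\<in>UNIV. \<bar>g v $ i\<bar>) = (\<Sum>i\<in>UNIV. \<bar>v $ i\<bar>) - \<bar>v $ b\<bar>"
        using ga by (simp add: sum.remove[of UNIV a])
      have "1 \<le> \<bar>v $ b\<bar>" using vi[of b] ab(3) Ints_nonzero_abs_ge1 by blast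
      moreover have "(\<Sum>i\<in>UNIV. \<bar>g v $ i\<bar>) \<ge> 0" by (simp add: sum_nonneg)
      ultimately have "nat \<lfloor>\<Sum>i\<in>UNIV. \<bar>g v $ i\<bar>\<rfloor> < nat \<lfloor>\<Sum>i\<in>UNIV. \<bar>v $ i\<bar>\<rfloor>"
        using s by linarith
      from less.hyps[OF this gv gv0] obtain h r
        where "lattice_aut h" "r \<in> \<int>" "r > 0" "h (g v) = r *\<^sub>R axis k 1" by blast
      then show ?thesis using lattice_aut_comp[of h g] g by (intro exI[of _ "h \<circ> g"]) auto
    next
      case False
      define g where "g = (\<lambda>x :: real^'n. \<chi> l. x $ (Transposition.transpose i k l))"
      have g: "lattice_aut g" unfolding g_def by (rule lattice_aut_permute) simp
      have gv: "g v = (v $ i) *\<^sub>R axis k 1"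
        using False by (auto simp: g_def vec_eq_iff axis_def Transposition.transpose_def)
      show ?thesis
      proof (cases "v $ i > 0")
        case True
        then show ?thesis using g gv vi by blast
      next
        case neg: False
        have "lattice_aut (uminus \<circ> g)" by (intro lattice_aut_comp g lattice_aut_uminus)
        then show ?thesis using gv vi[of i] neg i
          by (intro exI[of _ "uminus \<circ> g"] exI[of _ "- (v $ i)"]) auto
      qed
    qed
  qed
  then show ?thesis using that by blast
qed

text \<open>The images of the unit vectors under \<open>g\<close> form an integer matrix. The matrix
  of \<open>inv g\<close> inverts it over the integers, since the embedding of integer matrices into
  real ones is injective and multiplicative.\<close>

lemma unimodular_equivI:
  fixes g :: "real^'n \<Rightarrow> real^'n"
  assumes "lattice_aut g" "b \<in> integer_lattice" "(\<lambda>x. g x + b) ` P = Q"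
  shows "P \<cong>\<^sub>\<int> Q"
proof -
  \<comment> \<open>For a lattice automorphism the entries are integral already; the floor only
    changes their type.\<close>
  define M where "M h = (\<chi> i j. \<lfloor>h (axis j 1) $ i\<rfloor>)" for h :: "real^'n \<Rightarrow> real^'n"
  have M: "map_matrix real_of_int (M h) = matrix h" if "lattice_aut h" for h
  proof -
    have "h (axis j 1) $ i \<in> \<int>" for i j
      using lattice_autD(6)[OF that, of "axis j 1"] integer_lattice_axis[of 1 j]
      by (simp add: integer_lattice_def)
    then have "real_of_int \<lfloor>h (axis j 1) $ i\<rfloor> = h (axis j 1) $ i" for i j
      by (metis Ints_cases floor_of_int)
    then show ?thesis
      by (simp add: M_def map_matrix_def matrix_def vec_eq_iff)
  qed
  have inj: "A = B" if "map_matrix real_of_int A = map_matrix real_of_int B" for A B :: "int^'n^'n"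
    using that by (simp add: map_matrix_def vec_eq_iff)
  have i: "lattice_aut (inv g)" using assms lattice_aut_inv by blast
  have "g \<circ> inv g = id" "inv g \<circ> g = id"
    using lattice_autD(3,4)[OF assms(1)] by (simp_all add: surj_iff)
  then have "matrix g ** matrix (inv g) = mat 1" "matrix (inv g) ** matrix g = mat 1"
    using matrix_compose[OF lattice_autD(1)[OF i] lattice_autD(1)[OF assms(1)]]
      matrix_compose[OF lattice_autD(1)[OF assms(1)] lattice_autD(1)[OF i]]
    by (simp_all add: matrix_id_mat_1)
  then have "M g ** M (inv g) = mat 1" "M (inv g) ** M g = mat 1"
    by (auto intro!: inj simp: map_matrix_of_int_mult map_matrix_of_int_one M[OF assms(1)] M[OF i])
  then have "invertible (M g)" by (auto simp: invertible_def)
  moreover have "(\<lambda>x. g x + b) = (\<lambda>x. map_matrix real_of_int (M g) *v x + b)"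
    using lattice_autD(1)[OF assms(1)] by (simp add: M[OF assms(1)] matrix_works)
  ultimately show ?thesis
    unfolding unimodular_equiv_def affine_unimodular_def using assms by blast
qed

lemma affine_unimodularE:
  fixes f :: "real^'n \<Rightarrow> real^'n"
  assumes "affine_unimodular f"
  obtains g b where "lattice_aut g" "b \<in> integer_lattice" "f = (\<lambda>x. g x + b)"
proof -
  from assms obtain A :: "int^'n^'n" and b where A: "invertible A" "b \<in> integer_lattice"
    "f = (\<lambda>x. map_matrix real_of_int A *v x + b)" unfolding affine_unimodular_def by blast
  then obtain B where B: "A ** B = mat 1" "B ** A = mat 1" by (auto simp: invertible_def)
  have "lattice_aut (\<lambda>x. map_matrix real_of_int A *v x)"
    by (rule lattice_autI[of _ "\<lambda>x. map_matrix real_of_int B *v x"])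
      (simp_all add: matrix_vector_mul_assoc map_matrix_of_int_mult[symmetric] B
        map_matrix_of_int_one integer_mat_vec)
  then show ?thesis using A(2,3) by (rule that)
qed

subsection \<open>Lattice polytopes\<close>

text \<open>Krein-Milman in one direction; in the other, the extreme points of a hull are among its
  generators. The generators need not be vertices, so that affine images can be treated generator by
  generator.\<close>

lemma lattice_polytope_iff:
  "lattice_polytope P \<longleftrightarrow>
    (\<exists>V. finite V \<and> V \<noteq> {} \<and> V \<subseteq> integer_lattice \<and> P = convex hull V)"
proof
  assume P: "lattice_polytope P"
  define V where "V = {v. v extreme_point_of P}"
  have "P = convex hull V"
    unfolding V_def using P
    by (intro Krein_Milman_Minkowski) (auto simp: lattice_polytope_def polytope_imp_compact polytope_imp_convex)
  moreover have "finite V"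
    using P finite_polyhedron_extreme_points polytope_imp_polyhedron
    by (auto simp: V_def lattice_polytope_def)
  moreover have "V \<subseteq> integer_lattice" "P \<noteq> {}" using P by (auto simp: lattice_polytope_def V_def)
  ultimately show "\<exists>V. finite V \<and> V \<noteq> {} \<and> V \<subseteq> integer_lattice \<and> P = convex hull V"
    by (intro exI[of _ V] conjI notI) (fact | simp)+
next
  assume "\<exists>V. finite V \<and> V \<noteq> {} \<and> V \<subseteq> integer_lattice \<and> P = convex hull V"
  then obtain V where V: "finite V" "V \<noteq> {}" "V \<subseteq> integer_lattice" "P = convex hull V" by blast
  then have "{v. v extreme_point_of P} \<subseteq> integer_lattice"
    using extreme_point_of_convex_hull by blast
  then show "lattice_polytope P"
    using V unfolding lattice_polytope_def polytope_def by auto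
qed

lemma lattice_polytopeE:
  assumes "lattice_polytope P"
  obtains V where "finite V" "V \<noteq> {}" "V \<subseteq> integer_lattice" "P = convex hull V" "V \<subseteq> P"
  using assms hull_subset unfolding lattice_polytope_iff by metis

lemma lattice_polytopeD:
  assumes "lattice_polytope P"
  shows "convex P" "compact P" "closed P" "bounded P" "P \<noteq> {}"
  using assms by (auto simp: lattice_polytope_def polytope_imp_convex polytope_imp_compact
      polytope_imp_closed polytope_imp_bounded)

lemma convex_hull_affine_image:
  assumes "linear g"
  shows "(\<lambda>x. g x + b) ` (convex hull V) = convex hull ((\<lambda>x. g x + b) ` V)"
proof -
  have "(\<lambda>x. g x + b) ` S = (+) b ` g ` S" for S by (auto simp: add.commute)
  then show ?thesis
    using convex_hull_linear_image[OF assms, of V] convex_hull_translation[of b "g ` V"] by simp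
qed

lemma lattice_polytope_affine_image:
  assumes "lattice_polytope P" "linear g" "b \<in> integer_lattice"
    "\<And>x. x \<in> integer_lattice \<Longrightarrow> g x \<in> integer_lattice"
  shows "lattice_polytope ((\<lambda>x. g x + b) ` P)"
proof -
  from assms(1) obtain V where V: "finite V" "V \<noteq> {}" "V \<subseteq> integer_lattice" "P = convex hull V"
    by (rule lattice_polytopeE)
  show ?thesis
    unfolding lattice_polytope_iff V(4) convex_hull_affine_image[OF assms(2)]
    using V assms(3,4)
    by (intro exI[of _ "(\<lambda>x. g x + b) ` V"]) (auto intro!: integer_lattice_add)
qed

section \<open>Full dimension and interior points\<close>

definition nondegenerate :: "'a::euclidean_space set \<Rightarrow> bool"
  where "nondegenerate S \<longleftrightarrow> (\<forall>u c. (\<forall>x\<in>S. u \<bullet> x = c) \<longrightarrow> u = 0)"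

lemma nondegenerate_iff_interior:
  assumes "convex S"
  shows "nondegenerate S \<longleftrightarrow> interior S \<noteq> {}"
proof
  assume S: "nondegenerate S"
  show "interior S \<noteq> {}"
  proof
    assume "interior S = {}"
    then obtain a b where "a \<noteq> 0" "S \<subseteq> {x. a \<bullet> x = b}"
      by (rule empty_interior_subset_hyperplane[OF assms])
    then show False using S unfolding nondegenerate_def by blast
  qed
next
  assume i: "interior S \<noteq> {}"
  show "nondegenerate S"
    unfolding nondegenerate_def
  proof (intro allI impI)
    fix u c assume "\<forall>x\<in>S. u \<bullet> x = c"
    then have "interior S \<subseteq> interior {x. u \<bullet> x = c}" by (intro interior_mono) auto
    then show "u = 0" using i interior_hyperplane[of u c] by blast
  qed
qed

text \<open>A hyperplane around the image pulls back along the adjoint of \<open>g\<close> to one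
  around \<open>S\<close>, whose normal vector must vanish; surjectivity of \<open>g\<close> then
  makes \<open>u\<close> vanish.\<close>

lemma nondegenerate_affine_image:
  assumes "nondegenerate S" "linear g" "surj g"
  shows "nondegenerate ((\<lambda>x. g x + b) ` S)"
  unfolding nondegenerate_def
proof (intro allI impI)
  fix u c assume "\<forall>x\<in>(\<lambda>x. g x + b) ` S. u \<bullet> x = c"
  then have "\<forall>x\<in>S. adjoint g u \<bullet> x = c - u \<bullet> b"
    using adjoint_works[OF assms(2)] by (auto simp: inner_add_right inner_commute algebra_simps)
  then have "adjoint g u = 0" using assms(1) by (auto simp: nondegenerate_def)
  then have "u \<bullet> g x = 0" for x
    using adjoint_works[OF assms(2), of x u] by (simp add: inner_commute)
  then have "u \<bullet> u = 0" using assms(3) by (metis surjD)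
  then show "u = 0" by simp
qed

text \<open>A point of \<open>S\<close> outside the interior admits a nontrivial supporting
  functional, because interior and relative interior agree for full-dimensional convex sets.
  Interior points are thus found by showing that a functional minimal at \<open>x\<close> is
  zero.\<close>

lemma interiorI_support:
  assumes "convex S" "nondegenerate S" "x \<in> S"
    "\<And>u. (\<And>y. y \<in> S \<Longrightarrow> u \<bullet> x \<le> u \<bullet> y) \<Longrightarrow> u = 0"
  shows "x \<in> interior S"
proof (rule ccontr)
  assume "x \<notin> interior S"
  moreover have "rel_interior S = interior S"
    using assms(1,2) by (intro rel_interior_nonempty_interior) (simp add: nondegenerate_iff_interior)
  ultimately have "x \<notin> rel_interior S" by simp
  then show False
    using supporting_hyperplane_rel_boundary[OF assms(1,3)] assms(4) by metis
qed

text \<open>The start \<open>x\<close> is any real point of \<open>P\<close>: the segments that the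
  pigeonhole argument produces do not begin at lattice points in general.\<close>

definition long_segment :: "real \<Rightarrow> (real^'n) set \<Rightarrow> bool"
  where "long_segment N P \<longleftrightarrow> (\<exists>x\<in>P. \<exists>v\<in>integer_lattice. v \<noteq> 0 \<and> x + N *\<^sub>R v \<in> P)"

text \<open>Parametrises space by coordinates along the edges \<open>q\<close> of a simplex; the
  columns of its matrix are the vectors \<open>q i\<close>.\<close>

definition lin_comb :: "('n \<Rightarrow> real^'n) \<Rightarrow> real^'n \<Rightarrow> real^'n"
  where "lin_comb q c = (\<Sum>i\<in>UNIV. c $ i *\<^sub>R q i)"

lemma linear_lin_comb: "linear (lin_comb q)"
  by (rule linearI) (auto simp: lin_comb_def sum.distrib scaleR_add_left scaleR_sum_right)

lemma lin_comb_axis: "lin_comb q (axis i 1) = q i"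
proof -
  have "lin_comb q (axis i 1) = (\<Sum>j\<in>UNIV. if j = i then q j else 0)"
    unfolding lin_comb_def by (intro sum.cong) (auto simp: axis_def)
  then show ?thesis by simp
qed

lemma lin_comb_lattice:
  "(\<And>i. q i \<in> integer_lattice) \<Longrightarrow> c \<in> integer_lattice \<Longrightarrow> lin_comb q c \<in> integer_lattice"
  unfolding lin_comb_def
  by (intro integer_lattice_sum integer_lattice_scaleR) (auto simp: integer_lattice_def)

text \<open>The simplex is chosen with maximal determinant; Cramer's rule then bounds the coordinates.\<close>

lemma maximal_simplex:
  fixes P :: "(real^'n) set"
  assumes "lattice_polytope P" "nondegenerate P"
  obtains V p0 q where "finite V" "V \<subseteq> integer_lattice" "P = convex hull V" "p0 \<in> V"
    "\<And>i. p0 + q i \<in> V" "bij (lin_comb q)" "\<And>v. v \<in> V \<Longrightarrow> \<exists>c. lin_comb q c = v - p0 \<and> (\<forall>i. \<bar>c $ i\<bar> \<le> 1)"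
proof -
  from assms(1) obtain V where V: "finite V" "V \<noteq> {}" "V \<subseteq> integer_lattice" "P = convex hull V"
    by (rule lattice_polytopeE)
  obtain p0 where p0: "p0 \<in> V" using V by blast
  define S where "S = (\<lambda>v. v - p0) ` V"
  have spanS: "span S = UNIV"
  proof (rule ccontr)
    assume "span S \<noteq> UNIV"
    then obtain a where a: "a \<noteq> 0" "span S \<subseteq> {x. a \<bullet> x = 0}"
      using span_not_univ_subset_hyperplane by blast
    have "a \<bullet> v = a \<bullet> p0" if "v \<in> V" for v
      using a(2) span_base[of "v - p0" S] that by (auto simp: S_def inner_diff_right)
    then have "V \<subseteq> {x. a \<bullet> x = a \<bullet> p0}" by blast
    then have "P \<subseteq> {x. a \<bullet> x = a \<bullet> p0}"
      unfolding V by (intro hull_minimal) (auto simp: convex_hyperplane)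
    then show False using assms(2) a(1) unfolding nondegenerate_def by blast
  qed
  obtain B where B: "B \<subseteq> S" "independent B" "S \<subseteq> span B" "card B = dim S"
    by (rule basis_exists)
  have cB: "card B = CARD('n)" using B(4) dim_span[of S] spanS by simp
  have finB: "finite B" using B(2) by (rule independent_imp_finite)
  \<comment> \<open>Numbering a basis among the differences gives one choice of edges with nonzero
    determinant, so the maximum is nonzero as well.\<close>
  obtain \<beta> where \<beta>: "bij_betw \<beta> (UNIV :: 'n set) B"
    using finite_same_card_bij[of "UNIV :: 'n set" B] finB cB by auto
  define D where "D q = det (matrix (lin_comb q))" for q :: "'n \<Rightarrow> real^'n"
  have "inj (lin_comb \<beta>)"
  proof (rule linear_injective_0[OF linear_lin_comb, THEN iffD2], intro allI impI)
    fix c assume c: "lin_comb \<beta> c = 0"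
    have "(\<Sum>b\<in>B. (c $ inv_into UNIV \<beta> b) *\<^sub>R b) = lin_comb \<beta> c"
      unfolding lin_comb_def using \<beta>
      by (subst sum.reindex_bij_betw[OF \<beta>, symmetric]) (simp add: bij_betw_def)
    then have "c $ inv_into UNIV \<beta> b = 0" if "b \<in> B" for b
      using independentD[OF B(2) finB subset_refl, of "\<lambda>b. c $ inv_into UNIV \<beta> b"] that c by simp
    from this[of "\<beta> i" for i] show "c = 0"
      using bij_betwE[OF \<beta>] bij_betw_imp_inj_on[OF \<beta>] by (simp add: vec_eq_iff)
  qed
  then have D\<beta>: "D \<beta> \<noteq> 0" unfolding D_def using det_nz_iff_inj[OF linear_lin_comb] by blast
  define F where "F = {q :: 'n \<Rightarrow> real^'n. \<forall>i. q i \<in> S}"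
  have F: "F = PiE UNIV (\<lambda>_. S)" by (auto simp: F_def)
  have finF: "finite F" unfolding F using V(1) by (intro finite_PiE) (auto simp: S_def)
  have \<beta>F: "\<beta> \<in> F" using \<beta> B(1) by (auto simp: F_def bij_betw_def)
  obtain q where q: "q \<in> F" "\<And>q'. q' \<in> F \<Longrightarrow> \<bar>D q'\<bar> \<le> \<bar>D q\<bar>"
  proof -
    have "Max ((\<lambda>q. \<bar>D q\<bar>) ` F) \<in> (\<lambda>q. \<bar>D q\<bar>) ` F" using finF \<beta>F by (intro Max_in) auto
    then obtain q where "q \<in> F" "Max ((\<lambda>q. \<bar>D q\<bar>) ` F) = \<bar>D q\<bar>" by blast
    then show ?thesis using that[of q] finF by (metis Max_ge finite_imageI imageI)
  qed
  have Dq: "D q \<noteq> 0" using q(2)[OF \<beta>F] D\<beta> by auto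
  have injq: "inj (lin_comb q)" using Dq det_nz_iff_inj[OF linear_lin_comb, of q] by (simp add: D_def)
  have bijq: "bij (lin_comb q)"
    using injq linear_injective_imp_surjective[OF linear_lin_comb injq] by (simp add: bij_def)
  have mat: "matrix (lin_comb r) = (\<chi> i j. r j $ i)" for r :: "'n \<Rightarrow> real^'n"
    by (simp add: matrix_def lin_comb_axis)
  have co: "\<exists>c. lin_comb q c = v - p0 \<and> (\<forall>i. \<bar>c $ i\<bar> \<le> 1)" if "v \<in> V" for v
  proof -
    obtain c where c: "lin_comb q c = v - p0" using bij_is_surj[OF bijq] by (metis surjD)
    have "\<bar>c $ k\<bar> \<le> 1" for k
    proof -
      define q' where "q' = q(k := v - p0)"
      have "matrix (lin_comb q) *v c = v - p0"
        using c by (simp add: matrix_works linear_lin_comb)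
      then have "matrix (lin_comb q') =
          (\<chi> i j. if j = k then (matrix (lin_comb q) *v c) $ i else matrix (lin_comb q) $ i $ j)"
        unfolding mat by (auto simp: q'_def vec_eq_iff)
      then have "D q' = c $ k * D q" unfolding D_def by (simp only: cramer_lemma)
      moreover have "q' \<in> F" using q(1) that by (auto simp: F_def q'_def S_def)
      ultimately have "\<bar>c $ k\<bar> * \<bar>D q\<bar> \<le> 1 * \<bar>D q\<bar>" using q(2)[of q'] by (simp add: abs_mult)
      then show ?thesis using Dq by simp
    qed
    then show ?thesis using c by blast
  qed
  have pq: "p0 + q i \<in> V" for i
  proof -
    have "q i \<in> S" using q(1) by (simp add: F_def)
    then show ?thesis by (auto simp: S_def)
  qed
  show ?thesis using V(1,3,4) p0 pq bijq co by (rule that)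
qed

subsection \<open>Finiteness without long lattice segments\<close>

text \<open>The point is a convex combination with weight \<open>c $ i\<close> at
  \<open>p0 + q i\<close> and the remaining weight at \<open>p0\<close>. The proof normalises by the
  sum \<open>s\<close>, hence the separate case \<open>s = 0\<close>.\<close>

lemma simplex_mem:
  assumes "convex P" "p0 \<in> P" "\<And>i. p0 + q i \<in> P" "\<And>i. c $ i \<ge> 0" "(\<Sum>i\<in>UNIV. c $ i) \<le> 1"
  shows "p0 + lin_comb q c \<in> P"
proof -
  define s where "s = (\<Sum>i\<in>UNIV. c $ i)"
  show ?thesis
  proof (cases "s = 0")
    case True
    then have "c $ i = 0" for i using assms(4) by (simp add: s_def sum_nonneg_eq_0_iff)
    then show ?thesis using assms(2) by (simp add: lin_comb_def)
  next
    case False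
    then have s: "s > 0" using assms(4) by (simp add: s_def sum_nonneg order_less_le)
    have s1: "(\<Sum>i\<in>UNIV. c $ i / s) = 1" using s by (simp add: s_def flip: sum_divide_distrib)
    have "(\<Sum>i\<in>UNIV. (c $ i / s) *\<^sub>R (p0 + q i)) \<in> P"
      using s s1 assms by (intro convex_sum) auto
    then have "(1 - s) *\<^sub>R p0 + s *\<^sub>R (\<Sum>i\<in>UNIV. (c $ i / s) *\<^sub>R (p0 + q i)) \<in> P"
      using s assms(5) by (intro convexD[OF assms(1,2)]) (auto simp: s_def)
    also have "(\<Sum>i\<in>UNIV. (c $ i / s) *\<^sub>R (p0 + q i)) = p0 + (\<Sum>i\<in>UNIV. (c $ i / s) *\<^sub>R q i)"
      using s1 by (simp add: scaleR_add_right sum.distrib flip: scaleR_left.sum)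
    also have "s *\<^sub>R \<dots> = s *\<^sub>R p0 + lin_comb q c"
      using s by (simp add: lin_comb_def scaleR_add_right scaleR_sum_right)
    finally show ?thesis by (simp add: algebra_simps)
  qed
qed

text \<open>Pigeonhole principle: among the multiples of \<open>z\<close>, two agree up to \<open>1 / m\<close> in all coordinates
  modulo the lattice spanned by \<open>q\<close>. Their difference is a lattice vector, which has to vanish, as
  \<open>N\<close> times this vector would fit into the simplex.\<close>

lemma simplex_multiple_in_sublattice:
  fixes P :: "(real^'n) set"
  assumes P: "convex P" "p0 \<in> P" "\<And>i. p0 + q i \<in> P" and q: "\<And>i. q i \<in> integer_lattice"
    and b: "bij (lin_comb q)" and N: "N > 0" and ns: "\<not> long_segment (real N) P"
    and z: "z \<in> integer_lattice"
  obtains d :: nat and \<zeta> where "1 \<le> d" "d \<le> (CARD('n) * N) ^ CARD('n)" "\<zeta> \<in> integer_lattice"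
    "lin_comb q \<zeta> = real d *\<^sub>R z"
proof -
  \<comment> \<open>Coordinates of size at most \<open>1 / m\<close>, multiplied by
    \<open>N\<close>, are at most \<open>1 / CARD('n)\<close> each, so their sum stays within the
    bound 1 of \<open>simplex_mem\<close>.\<close>
  define m where "m = CARD('n) * N"
  have m: "m > 0" using N by (simp add: m_def)
  obtain g where g: "lin_comb q g = z" using bij_is_surj[OF b] by (metis surjD)
  \<comment> \<open>There are \<open>m ^ CARD('n)\<close> cells, but one more multiple of
    \<open>z\<close>, since the factor 0 is included.\<close>
  define cell where "cell k = (\<lambda>i. nat \<lfloor>real m * frac (real k * g $ i)\<rfloor>)" for k :: nat
  have "cell k i < m" for k i
  proof -
    have "real m * frac (real k * g $ i) < real m * 1"
      using m by (intro mult_strict_left_mono frac_lt_1) auto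
    moreover have "0 \<le> real m * frac (real k * g $ i)" by (simp add: frac_ge_0)
    ultimately have "\<lfloor>real m * frac (real k * g $ i)\<rfloor> < int m" by (simp add: floor_less_iff)
    then show ?thesis unfolding cell_def using m by linarith
  qed
  then have "cell ` {0..m ^ CARD('n)} \<subseteq> PiE UNIV (\<lambda>_. {..<m})" by auto
  moreover have "finite (PiE (UNIV::'n set) (\<lambda>_. {..<m}))" by (intro finite_PiE) auto
  ultimately have "card (cell ` {0..m ^ CARD('n)}) \<le> card (PiE (UNIV::'n set) (\<lambda>_. {..<m}))"
    by (intro card_mono)
  also have "\<dots> = m ^ CARD('n)" by (simp add: card_PiE)
  finally have "card (cell ` {0..m ^ CARD('n)}) < card {0..m ^ CARD('n)}" by simp
  then have "\<not> inj_on cell {0..m ^ CARD('n)}" by (rule pigeonhole)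
  then obtain k k' where k: "k < k'" "k' \<le> m ^ CARD('n)" "cell k = cell k'"
    unfolding inj_on_def by (metis atLeastAtMost_iff linorder_neqE_nat)
  define d where "d = k' - k"
  define \<zeta> where "\<zeta> = (\<chi> i. real_of_int (\<lfloor>real k' * g $ i\<rfloor> - \<lfloor>real k * g $ i\<rfloor>))"
  define \<delta> where "\<delta> = (\<chi> i. frac (real k' * g $ i) - frac (real k * g $ i))"
  have \<zeta>: "\<zeta> \<in> integer_lattice" by (auto simp: integer_lattice_def \<zeta>_def)
  have dg: "real d *\<^sub>R g = \<zeta> + \<delta>"
    using k(1) by (simp add: vec_eq_iff d_def \<zeta>_def \<delta>_def frac_def of_nat_diff algebra_simps)
  have \<delta>: "\<bar>\<delta> $ i\<bar> * real m \<le> 1" for i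
  proof -
    define A B where "A = real m * frac (real k' * g $ i)" and "B = real m * frac (real k * g $ i)"
    have "A \<ge> 0" "B \<ge> 0" by (auto simp: A_def B_def frac_ge_0)
    moreover have "nat \<lfloor>A\<rfloor> = nat \<lfloor>B\<rfloor>"
      using fun_cong[OF k(3), of i] by (simp add: cell_def A_def B_def)
    ultimately have "\<bar>A - B\<bar> \<le> 1" by linarith
    moreover have "A - B = real m * \<delta> $ i"
      by (simp add: \<delta>_def A_def B_def right_diff_distrib)
    ultimately show ?thesis by (simp add: abs_mult mult.commute)
  qed
  define v where "v = real d *\<^sub>R z - lin_comb q \<zeta>"
  have v: "v \<in> integer_lattice"
    unfolding v_def using z \<zeta> q by (intro integer_lattice_intros lin_comb_lattice) auto
  have "lin_comb q (real d *\<^sub>R g) = lin_comb q \<zeta> + lin_comb q \<delta>"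
    unfolding dg by (simp add: linear_add linear_lin_comb)
  then have v\<delta>: "v = lin_comb q \<delta>"
    using linear_scale[OF linear_lin_comb, of q "real d" g] by (simp add: v_def g)
  have "v = 0"
  proof (rule ccontr)
    assume "v \<noteq> 0"
    \<comment> \<open>The coordinates \<open>\<delta>\<close> may have both signs, so
      \<open>N\<close> times \<open>v\<close> need not point from \<open>p0\<close> into the
      simplex. The segment joins the points given by the negative and the positive part of
      \<open>\<delta>\<close>, which differ by exactly this vector.\<close>
    have part: "p0 + lin_comb q (\<chi> i. real N * max 0 (e * \<delta> $ i)) \<in> P" if "\<bar>e\<bar> = 1" for e
    proof (rule simplex_mem[OF P])
      have "real N * max 0 (e * \<delta> $ i) \<le> 1 / CARD('n)" for i
      proof -
        have "max 0 (e * \<delta> $ i) \<le> \<bar>\<delta> $ i\<bar>"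
          using that abs_ge_self[of "e * \<delta> $ i"] by (simp add: abs_mult)
        then have "real N * max 0 (e * \<delta> $ i) * CARD('n) \<le> real N * \<bar>\<delta> $ i\<bar> * CARD('n)"
          by (intro mult_right_mono mult_left_mono) auto
        also have "\<dots> \<le> 1" using \<delta>[of i] by (simp add: m_def algebra_simps)
        finally show ?thesis by (simp add: field_simps)
      qed
      then have "(\<Sum>i\<in>(UNIV::'n set). real N * max 0 (e * \<delta> $ i)) \<le> (\<Sum>i\<in>(UNIV::'n set). 1 / CARD('n))"
        by (intro sum_mono)
      then show "(\<Sum>i\<in>UNIV. (\<chi> i. real N * max 0 (e * \<delta> $ i)) $ i) \<le> 1" by simp
    qed simp
    have "(\<chi> i. real N * max 0 (1 * \<delta> $ i)) = (\<chi> i. real N * max 0 (- 1 * \<delta> $ i)) + real N *\<^sub>R \<delta>"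
      by (auto simp: vec_eq_iff max_def algebra_simps)
    then have "p0 + lin_comb q (\<chi> i. real N * max 0 (1 * \<delta> $ i)) =
        p0 + lin_comb q (\<chi> i. real N * max 0 (- 1 * \<delta> $ i)) + real N *\<^sub>R v"
      by (simp only: v\<delta> linear_add linear_scale linear_lin_comb add.assoc)
    then have "p0 + lin_comb q (\<chi> i. real N * max 0 (- 1 * \<delta> $ i)) + real N *\<^sub>R v \<in> P"
      using part[of 1] by (simp only: abs_one)
    moreover have "p0 + lin_comb q (\<chi> i. real N * max 0 (- 1 * \<delta> $ i)) \<in> P"
      by (rule part) simp
    ultimately have "long_segment (real N) P"
      unfolding long_segment_def using v \<open>v \<noteq> 0\<close> by blast
    then show False using ns by simp
  qed
  then have "lin_comb q \<zeta> = real d *\<^sub>R z" by (simp add: v_def)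
  moreover have "1 \<le> d" "d \<le> (CARD('n) * N) ^ CARD('n)" using k by (auto simp: d_def m_def)
  ultimately show ?thesis using that \<zeta> by blast
qed

section \<open>Finitely many normal forms\<close>

definition lattice_box :: "nat \<Rightarrow> (real^'n) set"
  where "lattice_box M = {c. \<forall>i. real M * c $ i \<in> \<int> \<and> \<bar>c $ i\<bar> \<le> 1}"

lemma finite_lattice_box:
  assumes "M > 0"
  shows "finite (lattice_box M :: (real^'n) set)"
proof (rule finite_subset)
  define I where "I = (\<lambda>k. real_of_int k / real M) ` {- int M..int M}"
  show "lattice_box M \<subseteq> vec_lambda ` PiE (UNIV :: 'n set) (\<lambda>_. I)"
  proof
    fix c :: "real^'n" assume c: "c \<in> lattice_box M"
    have "c $ i \<in> I" for i
    proof -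
      from c have "real M * c $ i \<in> \<int>" and b: "\<bar>c $ i\<bar> \<le> 1" by (auto simp: lattice_box_def)
      then obtain k where k: "real M * c $ i = real_of_int k" by (auto elim: Ints_cases)
      have "\<bar>real M * c $ i\<bar> \<le> real M * 1"
        unfolding abs_mult using b by (simp add: mult_left_le)
      then have "k \<in> {- int M..int M}" unfolding k by auto
      moreover have "c $ i = real_of_int k / real M" using k assms by (simp add: field_simps)
      ultimately show ?thesis unfolding I_def by blast
    qed
    then show "c \<in> vec_lambda ` PiE UNIV (\<lambda>_. I)"
      by (intro image_eqI[of _ _ "vec_nth c"]) auto
  qed
  show "finite (vec_lambda ` PiE (UNIV :: 'n set) (\<lambda>_. I))"
    by (intro finite_imageI finite_PiE) (auto simp: I_def)
qed

text \<open>Choosing for each key one element that has it reaches every class. Keys are given by a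
  relation, not a function, because an element may have several of them.\<close>

lemma finite_quotient_key:
  assumes "equiv UNIV R" "finite F" "\<And>x. x \<in> S \<Longrightarrow> \<exists>a\<in>F. r x a"
    "\<And>x y a. x \<in> S \<Longrightarrow> y \<in> S \<Longrightarrow> r x a \<Longrightarrow> r y a \<Longrightarrow> (x, y) \<in> R"
  shows "finite (S // R)"
proof (rule finite_subset[OF _ finite_imageI[OF assms(2)]])
  show "S // R \<subseteq> (\<lambda>a. R `` {SOME x. x \<in> S \<and> r x a}) ` F"
  proof
    fix X assume "X \<in> S // R"
    then obtain x where x: "x \<in> S" "X = R `` {x}" by (rule quotientE)
    from assms(3)[OF x(1)] obtain a where a: "a \<in> F" "r x a" by blast
    define y where "y = (SOME y. y \<in> S \<and> r y a)"
    have "y \<in> S \<and> r y a" unfolding y_def by (rule someI[of _ x]) (use x a in auto)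
    then have "(x, y) \<in> R" using assms(4) x(1) a(2) by blast
    then have "X = R `` {y}" using x(2) equiv_class_eq[OF assms(1)] by blast
    then show "X \<in> (\<lambda>a. R `` {SOME x. x \<in> S \<and> r x a}) ` F" using a(1) unfolding y_def by blast
  qed
qed

text \<open>A key of \<open>P\<close> consists of \<open>P\<close> and of the lattice, both written
  in the edge coordinates of a simplex of maximal determinant. If \<open>T\<close> and
  \<open>T'\<close> realise the same key, then \<open>T' \<circ> inv T\<close> preserves the lattice
  and, after a translation, carries one polytope to the other. Both components of a key are
  determined by subsets of the finite box \<open>Y\<close>.\<close>

theorem finite_classes_no_long_segment:
  assumes N: "N > 0"
  shows "finite ({P :: (real^'n) set. lattice_polytope P \<and> nondegenerate P \<and>
    \<not> long_segment (real N) P} // {(P, Q). P \<cong>\<^sub>\<int> Q})"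
proof -
  define K where "K = (CARD('n) * N) ^ CARD('n)"
  \<comment> \<open>A common multiple of all factors \<open>d \<le> K\<close> that the pigeonhole
    argument can return, hence one denominator for all lattice vectors.\<close>
  define M :: nat where "M = fact K"
  define Y :: "(real^'n) set" where "Y = lattice_box M"
  have finY: "finite Y" using finite_lattice_box[of M] by (simp add: Y_def M_def)
  define F where "F = (\<lambda>W. convex hull W) ` Pow Y \<times>
    (\<lambda>B. {c + \<zeta> | c \<zeta>. c \<in> B \<and> \<zeta> \<in> integer_lattice}) ` Pow Y"
  define r where "r P a = (\<exists>T b. linear T \<and> bij T \<and> b \<in> integer_lattice \<and>
      P = (\<lambda>x. T x + b) ` fst a \<and> T ` snd a = integer_lattice)"
    for P :: "(real^'n) set" and a :: "(real^'n) set \<times> (real^'n) set"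
  show ?thesis
  proof (rule finite_quotient_key[OF equiv_unimodular, of F _ r])
    show "finite F" using finY by (simp add: F_def)
  next
    fix P Q :: "(real^'n) set" and a
    assume "r P a" "r Q a"
    then obtain T b T' b' where T: "linear T" "bij T" "b \<in> integer_lattice" "P = (\<lambda>x. T x + b) ` fst a"
        "T ` snd a = integer_lattice"
      and T': "linear T'" "bij T'" "b' \<in> integer_lattice" "Q = (\<lambda>x. T' x + b') ` fst a"
        "T' ` snd a = integer_lattice"
      unfolding r_def by blast
    define h where "h = T' \<circ> inv T"
    have i: "linear (inv T)" "bij (inv T)" "inv T (T x) = x" for x
      using T(1,2) by (auto simp: bij_imp_bij_inv inj_linear_imp_inv_linear bij_is_inj)
    have hT: "h (T x) = T' x" for x by (simp add: h_def i)
    have "h ` integer_lattice = integer_lattice"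
      unfolding T(5)[symmetric] image_image hT using T'(5) T(5) by simp
    then have "lattice_aut h"
      using i T' by (auto simp: lattice_aut_def h_def linear_compose bij_comp)
    moreover have "b' - h b \<in> integer_lattice"
      using lattice_autD(6)[OF calculation T(3)] T'(3) by (intro integer_lattice_diff)
    moreover have "(\<lambda>x. h x + (b' - h b)) ` P = Q"
      unfolding T(4) T'(4) image_image
      using lattice_autD(1)[OF calculation(1)] by (simp add: linear_add hT)
    ultimately have "P \<cong>\<^sub>\<int> Q" by (rule unimodular_equivI)
    then show "(P, Q) \<in> {(P, Q). P \<cong>\<^sub>\<int> Q}" by simp
  next
    fix P :: "(real^'n) set"
    assume "P \<in> {P. lattice_polytope P \<and> nondegenerate P \<and> \<not> long_segment (real N) P}"
    then have P: "lattice_polytope P" "nondegenerate P" "\<not> long_segment (real N) P" by auto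
    from maximal_simplex[OF P(1,2)] obtain V p0 q where V: "finite V" "V \<subseteq> integer_lattice"
      "P = convex hull V" "p0 \<in> V" "\<And>i. p0 + q i \<in> V" and b: "bij (lin_comb q)"
      and c: "\<And>v. v \<in> V \<Longrightarrow> \<exists>c. lin_comb q c = v - p0 \<and> (\<forall>i. \<bar>c $ i\<bar> \<le> 1)" by metis
    define T where "T = lin_comb q"
    have T: "linear T" "bij T" "surj T" "inj T"
      using b by (auto simp: T_def linear_lin_comb bij_def)
    have VP: "V \<subseteq> P" unfolding V(3) by (rule hull_subset)
    have q: "q i \<in> integer_lattice" for i
      using integer_lattice_diff[of "p0 + q i" p0] V(2,4,5) by auto
    have denom: "real M *\<^sub>R c \<in> integer_lattice" if Tc: "T c \<in> integer_lattice" for c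
    proof -
      obtain d \<zeta> where d: "1 \<le> d" "d \<le> K" "\<zeta> \<in> integer_lattice" "T \<zeta> = real d *\<^sub>R T c"
      proof (rule simplex_multiple_in_sublattice[OF _ _ _ q b N P(3) Tc])
        show "convex P" using P(1) by (rule lattice_polytopeD)
        show "p0 \<in> P" "\<And>i. p0 + q i \<in> P" using V(4,5) VP by auto
      qed (auto simp: T_def K_def)
      have "\<zeta> = real d *\<^sub>R c" by (rule injD[OF T(4)]) (simp add: linear_scale T(1) d(4))
      moreover obtain e where e: "M = d * e" unfolding M_def
        using d(1,2) dvd_fact[of d K] by (auto elim: dvdE)
      ultimately have "real M *\<^sub>R c = real e *\<^sub>R \<zeta>" by (simp add: mult.commute)
      then show ?thesis using d(3) by (auto intro!: integer_lattice_scaleR)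
    qed
    then have Y: "c \<in> Y" if "T c \<in> integer_lattice" "\<And>i. \<bar>c $ i\<bar> \<le> 1" for c
      using that denom[of c] by (auto simp: Y_def lattice_box_def integer_lattice_def)
    define W where "W = {c \<in> Y. T c + p0 \<in> V}"
    have "V \<subseteq> (\<lambda>x. T x + p0) ` W"
    proof
      fix v assume v: "v \<in> V"
      then obtain c where c: "T c = v - p0" "\<And>i. \<bar>c $ i\<bar> \<le> 1" using c T_def by blast
      moreover have "c \<in> Y"
        using Y[of c] c v V(2,4) integer_lattice_diff[of v p0] by auto
      ultimately show "v \<in> (\<lambda>x. T x + p0) ` W"
        using v by (intro image_eqI[of _ _ c]) (auto simp: W_def)
    qed
    then have "V = (\<lambda>x. T x + p0) ` W" by (auto simp: W_def)
    then have PW: "P = (\<lambda>x. T x + p0) ` (convex hull W)"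
      unfolding V(3) by (simp add: convex_hull_affine_image[OF T(1)])
    define L where "L = {c. T c \<in> integer_lattice}"
    have TL: "T ` L = integer_lattice"
      unfolding L_def using T(3) by (auto simp: image_iff)
    have Tz: "T \<zeta> \<in> integer_lattice" if "\<zeta> \<in> integer_lattice" for \<zeta>
      unfolding T_def using q that by (rule lin_comb_lattice)
    \<comment> \<open>Since the edges are lattice vectors, \<open>L\<close> contains all integral
      vectors. Subtracting integer parts moves each element of \<open>L\<close> into the box, so
      \<open>L\<close> can be rebuilt from its part there.\<close>
    have "L = {c + \<zeta> | c \<zeta>. c \<in> L \<inter> Y \<and> \<zeta> \<in> integer_lattice}"
    proof (intro equalityI subsetI)
      fix x assume x: "x \<in> L"
      define \<zeta> where "\<zeta> = (\<chi> i. real_of_int \<lfloor>x $ i\<rfloor>)"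
      have \<zeta>: "\<zeta> \<in> integer_lattice" by (auto simp: integer_lattice_def \<zeta>_def)
      have "T (x - \<zeta>) \<in> integer_lattice"
        using integer_lattice_diff[of "T x" "T \<zeta>"] x Tz[OF \<zeta>] by (simp add: linear_diff T(1) L_def)
      moreover have "\<bar>(x - \<zeta>) $ i\<bar> \<le> 1" for i by (simp add: \<zeta>_def) linarith
      ultimately have "x - \<zeta> \<in> L \<inter> Y" using Y by (auto simp: L_def)
      moreover have "x = (x - \<zeta>) + \<zeta>" by simp
      ultimately show "x \<in> {c + \<zeta> | c \<zeta>. c \<in> L \<inter> Y \<and> \<zeta> \<in> integer_lattice}" using \<zeta> by blast
    next
      fix x assume "x \<in> {c + \<zeta> | c \<zeta>. c \<in> L \<inter> Y \<and> \<zeta> \<in> integer_lattice}"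
      then obtain c \<zeta> where c: "x = c + \<zeta>" "T c \<in> integer_lattice" "\<zeta> \<in> integer_lattice"
        unfolding L_def by blast
      have "T x = T c + T \<zeta>" unfolding c(1) by (rule linear_add[OF T(1)])
      then show "x \<in> L" using integer_lattice_add[OF c(2) Tz[OF c(3)]] by (simp add: L_def)
    qed
    then have "L \<in> (\<lambda>B. {c + \<zeta> | c \<zeta>. c \<in> B \<and> \<zeta> \<in> integer_lattice}) ` Pow Y"
      by (rule image_eqI) blast
    then have "(convex hull W, L) \<in> F" unfolding F_def W_def by blast
    moreover have "r P (convex hull W, L)"
      unfolding r_def using T PW TL V(2,4) by (intro exI[of _ T] exI[of _ p0]) auto
    ultimately show "\<exists>a\<in>F. r P a" by blast
  qed
qed

subsection \<open>Lattice polygons without interior lattice points\<close>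

lemma equiv_unimodular_trans: "P \<cong>\<^sub>\<int> Q \<Longrightarrow> Q \<cong>\<^sub>\<int> R \<Longrightarrow> P \<cong>\<^sub>\<int> R"
  using equiv_unimodular by (blast elim: equivE dest: transD)

text \<open>Surjectivity onto the integers makes \<open>\<phi>\<close> primitive, so
  \<open>P\<close> lies between two adjacent lattice hyperplanes. It may lie inside one of them;
  where this matters, \<open>nondegenerate\<close> excludes it.\<close>

definition width_one :: "(real^'n) set \<Rightarrow> bool"
  where "width_one P \<longleftrightarrow> (\<exists>\<phi> k. linear \<phi> \<and> \<phi> ` integer_lattice = \<int> \<and> k \<in> \<int> \<and>
    (\<forall>x\<in>P. k \<le> \<phi> x \<and> \<phi> x \<le> k + (1::real)))"

lemma width_oneI:
  assumes "linear \<phi>" "\<phi> ` integer_lattice = \<int>" "k \<in> \<int>"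
    "\<And>v. v \<in> V \<Longrightarrow> k \<le> \<phi> v \<and> \<phi> v \<le> k + (1::real)"
  shows "width_one (convex hull V)"
proof -
  have "convex (\<phi> -` {k..k + 1})" using assms(1) by (intro convex_linear_vimage) auto
  moreover have "V \<subseteq> \<phi> -` {k..k + 1}" using assms(4) by auto
  ultimately have "convex hull V \<subseteq> \<phi> -` {k..k + 1}" by (intro hull_minimal)
  then show ?thesis using assms(1-3) unfolding width_one_def by (intro exI[of _ \<phi>] exI[of _ k]) auto
qed

text \<open>Composition with \<open>\<rho>\<close> keeps the functional primitive. The dimension may
  drop under \<open>\<rho>\<close>, which transfers width one from the projected polygon to the
  three-dimensional polytope.\<close>

lemma width_one_pullback:
  assumes "width_one ((\<lambda>x. \<rho> x + b) ` P)" "linear \<rho>" "\<rho> ` integer_lattice = integer_lattice"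
    "b \<in> integer_lattice"
  shows "width_one P"
proof -
  from assms(1) obtain \<phi> k where \<phi>: "linear \<phi>" "\<phi> ` integer_lattice = \<int>" "k \<in> \<int>"
    "\<And>x. x \<in> P \<Longrightarrow> k \<le> \<phi> (\<rho> x + b) \<and> \<phi> (\<rho> x + b) \<le> k + (1::real)"
    unfolding width_one_def by auto
  have "(\<phi> \<circ> \<rho>) ` integer_lattice = \<int>"
    unfolding image_comp[symmetric] assms(3) by (rule \<phi>(2))
  moreover have "k - \<phi> b \<in> \<int>" using \<phi>(2,3) assms(4) by (intro Ints_diff) auto
  moreover have "linear (\<phi> \<circ> \<rho>)" using assms(2) \<phi>(1) by (rule linear_compose)
  moreover have "k - \<phi> b \<le> (\<phi> \<circ> \<rho>) x \<and> (\<phi> \<circ> \<rho>) x \<le> k - \<phi> b + 1" if "x \<in> P" for x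
    using \<phi>(4)[OF that] by (simp add: linear_add[OF \<phi>(1)])
  ultimately show ?thesis
    unfolding width_one_def by blast
qed

lemma inner_2: "(x::real^2) \<bullet> y = x $ 1 * y $ 1 + x $ 2 * y $ 2"
  by (simp add: inner_vec_def sum_2)

lemma vec_eq_2: "(x::real^2) = y \<longleftrightarrow> x $ 1 = y $ 1 \<and> x $ 2 = y $ 2"
  by (simp add: vec_eq_iff forall_2)

lemma integer_lattice_2: "(x::real^2) \<in> integer_lattice \<longleftrightarrow> x $ 1 \<in> \<int> \<and> x $ 2 \<in> \<int>"
  by (simp add: integer_lattice_def forall_2)

lemma double_unimodular_2_simplex_eq:
  "double_unimodular_2_simplex = {x. x $ 1 \<ge> 0 \<and> x $ 2 \<ge> 0 \<and> x $ 1 + x $ 2 \<le> 2}"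
proof (intro equalityI subsetI)
  fix x assume "x \<in> double_unimodular_2_simplex"
  then show "x \<in> {x. x $ 1 \<ge> 0 \<and> x $ 2 \<ge> 0 \<and> x $ 1 + x $ 2 \<le> 2}"
    unfolding double_unimodular_2_simplex_def convex_hull_3
    by (auto simp: std_basis_def axis_def)
next
  fix x :: "real^2" assume x: "x \<in> {x. x $ 1 \<ge> 0 \<and> x $ 2 \<ge> 0 \<and> x $ 1 + x $ 2 \<le> 2}"
  show "x \<in> double_unimodular_2_simplex"
    unfolding double_unimodular_2_simplex_def convex_hull_3 mem_Collect_eq
    using x
    by (intro exI[of _ "1 - (x $ 1 + x $ 2) / 2"] exI[of _ "x $ 1 / 2"] exI[of _ "x $ 2 / 2"])
      (auto simp: std_basis_def axis_def vec_eq_2 field_simps)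
qed

lemma Ints_between:
  fixes a b :: real
  assumes "b - a > 1"
  obtains j where "j \<in> \<int>" "a < j" "j < b"
proof -
  have "a < real_of_int \<lfloor>a\<rfloor> + 1" "real_of_int \<lfloor>a\<rfloor> + 1 < b" using assms by linarith+
  then show ?thesis using that[of "real_of_int \<lfloor>a\<rfloor> + 1"] by simp
qed

lemma Ints_less_iff: "a \<in> \<int> \<Longrightarrow> b \<in> \<int> \<Longrightarrow> a < b \<longleftrightarrow> a + 1 \<le> (b::real)"
  by (auto elim!: Ints_cases)

text \<open>If \<open>Q\<close> reaches only height one, the height shows width one. Otherwise no
  lattice point lies strictly inside the section at height one, as it would be interior to
  \<open>Q\<close>. A vertex at height \<open>h > 1\<close> and a base of length \<open>l\<close>
  force a section of length at least \<open>l * (1 - 1 / h)\<close>, so this is at most 1. Hence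
  \<open>l = 1\<close>, which gives width one after a shear, or \<open>l = h = 2\<close>, which
  gives the double simplex.\<close>

lemma hollow_polygon_with_base:
  fixes Q :: "(real^2) set"
  assumes Q: "lattice_polytope Q" "nondegenerate Q" and hollow: "interior Q \<inter> integer_lattice = {}"
    and y0: "\<And>x. x \<in> Q \<Longrightarrow> x $ 2 \<ge> 0"
    and l: "l \<in> \<int>" "l > 0" "0 \<in> Q" "vector [l, 0] \<in> Q"
    and base: "\<And>x. x \<in> Q \<Longrightarrow> x $ 2 = 0 \<Longrightarrow> 0 \<le> x $ 1 \<and> x $ 1 \<le> l"
  shows "width_one Q \<or> Q \<cong>\<^sub>\<int> double_unimodular_2_simplex"
proof -
  from Q(1) obtain V where V: "finite V" "V \<noteq> {}" "V \<subseteq> integer_lattice" "Q = convex hull V" "V \<subseteq> Q"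
    by (rule lattice_polytopeE)
  have cQ: "convex Q" using Q(1) by (rule lattice_polytopeD)
  have VI: "v $ 1 \<in> \<int>" "v $ 2 \<in> \<int>" if "v \<in> V" for v using V(3) that integer_lattice_2 by blast+
  show ?thesis
  proof (cases "\<exists>v\<in>V. v $ 2 > 1")
    case False
    have "width_one (convex hull V)"
    proof (rule width_oneI[of "\<lambda>x. x $ 2" 0])
      show "(\<lambda>x :: real^2. x $ 2) ` integer_lattice = \<int>"
        by (auto simp: integer_lattice_2 image_iff intro!: bexI[of _ "vector [0, _]"])
    qed (use False y0 V(5) in \<open>auto intro: linearI\<close>)
    then show ?thesis using V(4) by blast
  next
    case True
    then obtain p where p: "p \<in> V" "p $ 2 > 1" by blast
    \<comment> \<open>A functional minimal at \<open>vector [j, 1]\<close> has no horizontal part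
      because of the two neighbours, and no vertical part because \<open>0\<close> lies below and
      \<open>p\<close> above.\<close>
    have slice: False if "vector [\<alpha>, 1] \<in> Q" "vector [\<beta>, 1] \<in> Q" "j \<in> \<int>" "\<alpha> < j" "j < \<beta>" for \<alpha> \<beta> j
    proof -
      have "vector [j, 1] \<in> interior Q"
      proof (rule interiorI_support[OF cQ Q(2)])
        define t where "t = (j - \<alpha>) / (\<beta> - \<alpha>)"
        have t: "0 \<le> t" "t \<le> 1" using that by (auto simp: t_def field_simps)
        have "t * (\<beta> - \<alpha>) = j - \<alpha>" using that by (simp add: t_def)
        then have "vector [j, 1] = (1 - t) *\<^sub>R vector [\<alpha>, 1] + t *\<^sub>R (vector [\<beta>, 1] :: real^2)"
          by (simp add: vec_eq_2 vector_2 algebra_simps)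
        then show "vector [j, 1] \<in> Q" using convexD_alt[OF cQ that(1,2) t] by simp
      next
        fix u :: "real^2" assume u: "\<And>y. y \<in> Q \<Longrightarrow> u \<bullet> vector [j, 1] \<le> u \<bullet> y"
        have "u $ 1 * j \<le> u $ 1 * \<alpha>" "u $ 1 * j \<le> u $ 1 * \<beta>"
          using u[OF that(1)] u[OF that(2)] by (simp_all add: inner_2 vector_2)
        then have "u $ 1 = 0"
          using that(4,5) by (metis less_le_not_le linorder_neqE_linordered_idom mult_le_cancel_left)
        moreover have "u $ 2 \<le> 0" using u[OF l(3)] calculation by (simp add: inner_2 vector_2)
        moreover have "u $ 2 * 1 \<le> u $ 2 * p $ 2"
          using u[of p] p V(5) calculation by (auto simp add: inner_2 vector_2)
        then have "u $ 2 \<ge> 0" using p(2) by (metis less_le_not_le linear mult_le_cancel_left)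
        ultimately show "u = 0" by (simp add: vec_eq_2)
      qed
      moreover have "vector [j, 1] \<in> (integer_lattice :: (real^2) set)"
        using that(3) by (simp add: integer_lattice_2 vector_2)
      ultimately show False using hollow by blast
    qed
    \<comment> \<open>The two ends of the section at height one through the triangle with apex
      \<open>v\<close> over the base.\<close>
    have left: "vector [v $ 1 / v $ 2, 1] \<in> Q"
      and right: "vector [v $ 1 / v $ 2 + l * (1 - 1 / v $ 2), 1] \<in> Q" if "v \<in> V" "v $ 2 \<ge> 1" for v
    proof -
      have t: "0 \<le> 1 / v $ 2" "1 / v $ 2 \<le> 1" using that by auto
      have "vector [v $ 1 / v $ 2, 1] = (1 - 1 / v $ 2) *\<^sub>R 0 + (1 / v $ 2) *\<^sub>R v"
        "vector [v $ 1 / v $ 2 + l * (1 - 1 / v $ 2), 1] =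
          (1 - 1 / v $ 2) *\<^sub>R vector [l, 0] + (1 / v $ 2) *\<^sub>R v"
        using that by (auto simp: vec_eq_2 vector_2)
      then show "vector [v $ 1 / v $ 2, 1] \<in> Q"
        "vector [v $ 1 / v $ 2 + l * (1 - 1 / v $ 2), 1] \<in> Q"
        using convexD_alt[OF cQ l(3) _ t, of v] convexD_alt[OF cQ l(4) _ t, of v] V(5) that(1) by auto
    qed
    have lt: "p $ 1 / p $ 2 < p $ 1 / p $ 2 + l * (1 - 1 / p $ 2)" using p(2) l(2) by simp
    show ?thesis
    proof (cases "l = 1")
      case True
      \<comment> \<open>The section of the triangle under \<open>p\<close> meets the open interval
        from \<open>j\<close> to \<open>j + 1\<close>, so the whole section of \<open>Q\<close>
        stays in its closure. For base length one, the strip bounded by the lines from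
        \<open>(0,0)\<close> and \<open>(1,0)\<close> in direction \<open>(j,1)\<close> then
        contains every vertex.\<close>
      define j where "j = real_of_int \<lfloor>p $ 1 / p $ 2\<rfloor>"
      have j: "j \<in> \<int>" "j \<le> p $ 1 / p $ 2" "p $ 1 / p $ 2 < j + 1" by (auto simp: j_def)
      have p1: "p $ 2 \<ge> 1" using p by simp
      have strip: "j \<le> x" "x \<le> j + 1" if "vector [x, 1] \<in> Q" for x
      proof -
        show "j \<le> x"
          using slice[OF that right[OF p(1) p1] j(1)] lt j(2) by (cases "x < j") auto
        show "x \<le> j + 1"
          using slice[OF left[OF p(1) p1] that, of "j + 1"] j by (cases "j + 1 < x") auto
      qed
      have "width_one (convex hull V)"
      proof (rule width_oneI[of "\<lambda>x. x $ 1 - j * x $ 2" 0])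
        show "linear (\<lambda>x :: real^2. x $ 1 - j * x $ 2)"
          by (rule linearI) (auto simp: algebra_simps)
        show "(\<lambda>x :: real^2. x $ 1 - j * x $ 2) ` integer_lattice = \<int>"
        proof (intro equalityI subsetI)
          fix k :: real assume "k \<in> \<int>"
          then show "k \<in> (\<lambda>x :: real^2. x $ 1 - j * x $ 2) ` integer_lattice"
            by (intro image_eqI[of _ _ "vector [k, 0]"]) (auto simp: integer_lattice_2 vector_2)
        qed (use j(1) in \<open>auto simp: integer_lattice_2\<close>)
        fix v assume v: "v \<in> V"
        show "0 \<le> v $ 1 - j * v $ 2 \<and> v $ 1 - j * v $ 2 \<le> 0 + 1"
        proof (cases "v $ 2 = 0")
          case True
          then show ?thesis using base[of v] V(5) v \<open>l = 1\<close> by auto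
        next
          case False
          then have v2: "v $ 2 \<ge> 1"
            using y0[of v] V(5) v VI(2)[OF v] Ints_nonzero_abs_ge1[of "v $ 2"] by auto
          have "j \<le> v $ 1 / v $ 2" using strip(1)[OF left[OF v v2]] .
          moreover have "v $ 1 / v $ 2 + 1 * (1 - 1 / v $ 2) \<le> j + 1"
            using strip(2)[OF right[OF v v2]] \<open>l = 1\<close> by simp
          ultimately show ?thesis using v2 by (simp add: field_simps)
        qed
      qed simp
      then show ?thesis using V(4) by blast
    next
      case False
      then have l2: "l \<ge> 2" using l(1,2) Ints_less_iff[of 1 l] Ints_less_iff[of 0 l] by auto
      have h2: "v $ 2 = 2 \<and> l = 2" if v: "v \<in> V" "v $ 2 > 1" for v
      proof (rule ccontr)
        assume n: "\<not> (v $ 2 = 2 \<and> l = 2)"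
        have v2: "v $ 2 \<ge> 2" using that VI(2)[OF v(1)] Ints_less_iff[of 1 "v $ 2"] by auto
        have "l * (v $ 2 - 1) > v $ 2"
        proof (cases "l = 2")
          case True
          then show ?thesis using n v2 by auto
        next
          case False
          then have "l \<ge> 3" using l(1) l2 Ints_less_iff[of 2 l] by auto
          then have "3 * (v $ 2 - 1) \<le> l * (v $ 2 - 1)" using v2 by (intro mult_right_mono) auto
          then show ?thesis using v2 by auto
        qed
        then have "l * (1 - 1 / v $ 2) > 1" using v2 by (simp add: field_simps)
        then have "(v $ 1 / v $ 2 + l * (1 - 1 / v $ 2)) - v $ 1 / v $ 2 > 1" by linarith
        then obtain j where "j \<in> \<int>" "v $ 1 / v $ 2 < j" "j < v $ 1 / v $ 2 + l * (1 - 1 / v $ 2)"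
          by (rule Ints_between)
        then show False using slice[OF left[OF v(1)] right[OF v(1)]] v2 by auto
      qed
      have ph: "p $ 2 = 2" "l = 2" using h2 p by auto
      \<comment> \<open>The section now contains an interval of length exactly one, starting at
        \<open>c\<close>. It has no integer strictly inside, so \<open>c\<close> is integral and the
        shear \<open>g\<close> below takes \<open>p\<close> to \<open>(0,2)\<close>.\<close>
      define c where "c = p $ 1 / 2"
      have cl: "vector [c, 1] \<in> Q" "vector [c + 1, 1] \<in> Q"
        using left[OF p(1)] right[OF p(1)] ph by (simp_all add: c_def)
      have c: "c \<in> \<int>"
      proof (rule ccontr)
        assume "c \<notin> \<int>"
        then have "c < real_of_int \<lfloor>c\<rfloor> + 1" "real_of_int \<lfloor>c\<rfloor> + 1 < c + 1"
          using floor_correct[of c] Ints_of_int[of "\<lfloor>c\<rfloor>"] by (auto simp: less_le)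
        then show False using slice[OF cl, of "real_of_int \<lfloor>c\<rfloor> + 1"] by auto
      qed
      have strip: "c \<le> x" "x \<le> c + 1" if "vector [x, 1] \<in> Q" for x
        using slice[OF that cl(2) c] slice[OF cl(1) that, of "c + 1"] c
        by (cases "x < c"; cases "c + 1 < x"; simp)+
      define g where "g = (\<lambda>x :: real^2. x + (- c * x $ 2) *\<^sub>R axis 1 1)"
      have g: "lattice_aut g"
        unfolding g_def by (rule lattice_aut_transvection)
          (use c in \<open>auto simp: integer_lattice_2 axis_def algebra_simps intro!: linearI\<close>)
      have gx: "g x $ 1 = x $ 1 - c * x $ 2" "g x $ 2 = x $ 2" for x
        by (auto simp: g_def axis_def)
      have "g ` Q = double_unimodular_2_simplex"
      proof
        have "g ` V \<subseteq> double_unimodular_2_simplex"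
        proof
          fix w assume "w \<in> g ` V"
          then obtain v where v: "v \<in> V" "w = g v" by blast
          have vQ: "v \<in> Q" using v V(5) by blast
          consider "v $ 2 = 0" | "v $ 2 = 1" | "v $ 2 > 1"
            using VI(2)[OF v(1)] y0[OF vQ] Ints_less_iff[of 0 "v $ 2"] by fastforce
          then show "w \<in> double_unimodular_2_simplex"
          proof cases
            case 1
            then show ?thesis
              using base[OF vQ] ph by (simp add: double_unimodular_2_simplex_eq v(2) gx)
          next
            case 2
            then have "v = vector [v $ 1, 1]" by (simp add: vec_eq_2 vector_2)
            then show ?thesis
              using strip[of "v $ 1"] vQ 2 by (simp add: double_unimodular_2_simplex_eq v(2) gx)
          next
            case 3
            then have "v $ 2 = 2" using h2 v(1) by blast
            then show ?thesis
              using strip[OF left[OF v(1)]] strip[OF right[OF v(1)]] ph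
              by (simp add: double_unimodular_2_simplex_eq v(2) gx)
          qed
        qed
        then have "convex hull (g ` V) \<subseteq> double_unimodular_2_simplex"
          by (intro hull_minimal) (auto simp: double_unimodular_2_simplex_def)
        then show "g ` Q \<subseteq> double_unimodular_2_simplex"
          unfolding V(4) using convex_hull_linear_image[OF lattice_autD(1)[OF g]] by simp
        have "g 0 = 0" "g (vector [l, 0]) = 2 *\<^sub>R std_basis 1" "g p = 2 *\<^sub>R std_basis 2"
          by (simp_all add: vec_eq_2 gx vector_2 std_basis_def axis_def ph c_def)
        then have "{0, 2 *\<^sub>R std_basis 1, 2 *\<^sub>R std_basis 2} \<subseteq> g ` Q"
          using l(3,4) p(1) V(5) by (metis empty_subsetI image_eqI insert_subset subsetD)
        then show "double_unimodular_2_simplex \<subseteq> g ` Q"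
          unfolding double_unimodular_2_simplex_def
          by (intro hull_minimal convex_linear_image cQ lattice_autD(1)[OF g])
      qed
      then have "Q \<cong>\<^sub>\<int> double_unimodular_2_simplex"
        by (intro unimodular_equivI[OF g, of 0]) (auto simp: integer_lattice_0)
      then show ?thesis ..
    qed
  qed
qed

section \<open>From a polygon with a base on the axis to arbitrary polygons\<close>

lemma interior_lattice_affine_image:
  assumes g: "lattice_aut g" and b: "b \<in> integer_lattice"
    and "interior Q \<inter> integer_lattice = {}"
  shows "interior ((\<lambda>x. g x + b) ` Q) \<inter> integer_lattice = {}"
proof -
  have "(\<lambda>x. g x + b) ` Q = (+) b ` g ` Q" by (auto simp: add.commute)
  then have i: "interior ((\<lambda>x. g x + b) ` Q) = (+) b ` g ` interior Q"
    using interior_bijective_linear_image[OF lattice_autD(1,2)[OF g]] by (simp add: interior_translation)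
  have "x \<in> integer_lattice" if x: "b + g x \<in> integer_lattice" for x
  proof -
    have "g x \<in> integer_lattice" using integer_lattice_diff[OF x b] by simp
    then have "g x \<in> g ` integer_lattice" by (simp only: lattice_autD(5)[OF g])
    then show ?thesis by (simp add: inj_image_mem_iff[OF lattice_autD(3)[OF g]])
  qed
  then show ?thesis unfolding i using assms(3) by blast
qed

lemma linear_axis_2:
  fixes f :: "real^2 \<Rightarrow> real"
  assumes "linear f"
  shows "f x = x $ 1 * f (axis 1 1) + x $ 2 * f (axis 2 1)"
proof -
  have "x = x $ 1 *\<^sub>R axis 1 1 + x $ 2 *\<^sub>R axis 2 1" by (auto simp: vec_eq_2 axis_def)
  then have "f x = f (x $ 1 *\<^sub>R axis 1 1 + x $ 2 *\<^sub>R axis 2 1)" by simp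
  then show ?thesis by (simp add: linear_add[OF assms] linear_scale[OF assms])
qed

text \<open>Some facet is a lattice segment. A lattice automorphism makes it the horizontal bottom
  edge, and a lattice translation puts its left end at the origin, as
  \<open>hollow_polygon_with_base\<close> demands.\<close>

lemma hollow_polygon:
  fixes Q :: "(real^2) set"
  assumes Q: "lattice_polytope Q" "nondegenerate Q" and hollow: "interior Q \<inter> integer_lattice = {}"
  shows "width_one Q \<or> Q \<cong>\<^sub>\<int> double_unimodular_2_simplex"
proof -
  have pQ: "polytope Q" using Q(1) by (simp add: lattice_polytope_def)
  have "interior Q \<noteq> {}" using Q lattice_polytopeD(1) nondegenerate_iff_interior by blast
  then have dQ: "aff_dim Q = 2" using aff_dim_nonempty_interior[of Q] by simp
  obtain F where F: "F facet_of Q" using polytope_facet_exists[OF pQ] dQ by auto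
  obtain a \<beta> where a: "a \<noteq> 0" "Q \<subseteq> {x. a \<bullet> x \<le> \<beta>}" "F = Q \<inter> {x. a \<bullet> x = \<beta>}"
    using facet_of_polyhedron[OF polytope_imp_polyhedron[OF pQ] F] by metis
  have Fface: "F face_of Q" "F \<noteq> {}" "aff_dim F = 1" using F dQ by (auto simp: facet_of_def)
  have "lattice_polytope F"
    using face_of_polytope_polytope[OF pQ Fface(1)] Fface(2) Q(1)
    by (auto simp: lattice_polytope_def extreme_point_of_face[OF Fface(1)])
  then obtain W where W: "finite W" "W \<noteq> {}" "W \<subseteq> integer_lattice" "F = convex hull W" "W \<subseteq> F"
    by (rule lattice_polytopeE)
  obtain p where p: "p \<in> W" using W by blast
  have "\<not> W \<subseteq> {p}"
  proof
    assume "W \<subseteq> {p}"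
    then have "F = {p}" using W(4) p by (metis convex_hull_singleton insert_absorb2 insert_subset subset_singletonD empty_iff)
    then show False using Fface(3) by simp
  qed
  then obtain q where q: "q \<in> W" "q \<noteq> p" by blast
  have "q - p \<in> integer_lattice" "q - p \<noteq> 0" using p q W(3) by (auto intro: integer_lattice_diff)
  then obtain g0 r0 where g0: "lattice_aut g0" "r0 \<in> \<int>" "r0 > 0" "g0 (q - p) = r0 *\<^sub>R axis 1 1"
    by (rule lattice_aut_to_axis)
  text \<open>The facet is turned into the bottom edge, using a reflection if necessary.\<close>
  have "\<exists>g r h. lattice_aut g \<and> r \<noteq> 0 \<and> g (q - p) = r *\<^sub>R axis 1 1 \<and>
    (\<forall>x\<in>Q. h \<le> g x $ 2 \<and> (g x $ 2 = h \<longleftrightarrow> x \<in> F))"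
  proof -
    \<comment> \<open>The facet functional in the new coordinates. It vanishes along the edge and is
      thus a multiple of the second coordinate; the sign of the factor decides whether to
      reflect.\<close>
    define f where "f y = a \<bullet> inv g0 y" for y
    have lin: "linear f"
      using lattice_autD(1)[OF lattice_aut_inv[OF g0(1)]] unfolding f_def
      by (auto intro!: linearI simp: linear_add linear_scale inner_add_right)
    have fg: "f (g0 x) = a \<bullet> x" for x by (simp add: f_def inv_f_f lattice_autD(3)[OF g0(1)])
    have "f (r0 *\<^sub>R axis 1 1) = 0"
      using p q W(5) a(3) unfolding g0(4)[symmetric] fg by (auto simp: inner_diff_right)
    then have "f (axis 1 1) = 0" using g0(3) by (simp add: linear_scale[OF lin])
    then have f: "a \<bullet> x = g0 x $ 2 * f (axis 2 1)" for x
      using linear_axis_2[OF lin, of "g0 x"] by (simp add: fg)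
    have nz: "f (axis 2 1) \<noteq> 0" using a(1) f[of a] by auto
    define h where "h = \<beta> / f (axis 2 1)"
    have x: "g0 x $ 2 * f (axis 2 1) \<le> h * f (axis 2 1)" "x \<in> F \<longleftrightarrow> g0 x $ 2 = h" if "x \<in> Q" for x
      using that a(2,3) nz f[of x] by (auto simp: h_def)
    show ?thesis
    proof (cases "f (axis 2 1) < 0")
      case True
      then show ?thesis
        using g0 x by (intro exI[of _ g0] exI[of _ r0] exI[of _ h]) auto
    next
      case False
      then have pos: "f (axis 2 1) > 0" using nz by simp
      have "lattice_aut (uminus \<circ> g0)" using lattice_aut_comp[OF lattice_aut_uminus g0(1)] .
      moreover have "g0 x $ 2 \<le> h" if "x \<in> Q" for x using x(1)[OF that] pos by simp
      ultimately show ?thesis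
        using g0 x(2) by (intro exI[of _ "uminus \<circ> g0"] exI[of _ "- r0"] exI[of _ "- h"]) auto
    qed
  qed
  then obtain g r h where g: "lattice_aut g" "r \<noteq> 0" "g (q - p) = r *\<^sub>R axis 1 1"
    "\<And>x. x \<in> Q \<Longrightarrow> h \<le> g x $ 2" "\<And>x. x \<in> Q \<Longrightarrow> g x $ 2 = h \<longleftrightarrow> x \<in> F" by blast
  have WQ: "W \<subseteq> Q" using W(5) a(3) by blast
  have W2: "g w $ 2 = h" if "w \<in> W" for w using g(5) that WQ W(5) by blast
  have WI: "g w \<in> integer_lattice" if "w \<in> W" for w using lattice_autD(6)[OF g(1)] W(3) that by blast
  have linc: "linear (\<lambda>x. g x $ 1)"
    using lattice_autD(1)[OF g(1)] by (auto intro!: linearI simp: linear_add linear_scale)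
  define l0 where "l0 = Min ((\<lambda>x. g x $ 1) ` W)"
  define l1 where "l1 = Max ((\<lambda>x. g x $ 1) ` W)"
  have "l0 \<in> (\<lambda>x. g x $ 1) ` W" unfolding l0_def by (intro Min_in) (use W in auto)
  then obtain w0 where w0: "w0 \<in> W" "g w0 $ 1 = l0" by auto
  have "l1 \<in> (\<lambda>x. g x $ 1) ` W" unfolding l1_def by (intro Max_in) (use W in auto)
  then obtain w1 where w1: "w1 \<in> W" "g w1 $ 1 = l1" by auto
  have lW: "l0 \<le> g w $ 1" "g w $ 1 \<le> l1" if "w \<in> W" for w
    using that W(1) by (auto simp: l0_def l1_def)
  have "g q $ 1 - g p $ 1 = r"
    using g(3) linear_diff[OF lattice_autD(1)[OF g(1)], of q p]
    by (metis axis_nth mult.right_neutral real_scaleR_def vector_minus_component vector_scaleR_component)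
  then have l01: "l0 < l1" using lW[OF p] lW[OF q(1)] g(2) by linarith
  have lF: "l0 \<le> g x $ 1 \<and> g x $ 1 \<le> l1" if "x \<in> F" for x
  proof -
    have "convex ((\<lambda>x. g x $ 1) -` {l0..l1})" using linc by (intro convex_linear_vimage) auto
    moreover have "W \<subseteq> (\<lambda>x. g x $ 1) -` {l0..l1}" using lW by auto
    ultimately have "F \<subseteq> (\<lambda>x. g x $ 1) -` {l0..l1}" unfolding W(4) by (intro hull_minimal)
    then show ?thesis using that by auto
  qed
  define b where "b = - g w0"
  have b: "b \<in> integer_lattice" unfolding b_def using WI[OF w0(1)] by (rule integer_lattice_uminus)
  have b12: "b $ 1 = - l0" "b $ 2 = - h" using w0 W2 by (auto simp: b_def)
  define Q' where "Q' = (\<lambda>x. g x + b) ` Q"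
  have equiv: "Q \<cong>\<^sub>\<int> Q'" using g(1) b by (rule unimodular_equivI) (simp add: Q'_def)
  have "width_one Q' \<or> Q' \<cong>\<^sub>\<int> double_unimodular_2_simplex"
  proof (rule hollow_polygon_with_base)
    show "lattice_polytope Q'" unfolding Q'_def
      using Q(1) lattice_autD(1)[OF g(1)] b lattice_autD(6)[OF g(1)] by (rule lattice_polytope_affine_image)
    show "nondegenerate Q'" unfolding Q'_def
      using Q(2) lattice_autD(1,4)[OF g(1)] by (rule nondegenerate_affine_image)
    show "interior Q' \<inter> integer_lattice = {}" unfolding Q'_def
      using g(1) b hollow by (rule interior_lattice_affine_image)
    show "l1 - l0 \<in> \<int>" using WI[OF w0(1)] WI[OF w1(1)] w0 w1 by (auto simp: integer_lattice_2)
    show "l1 - l0 > 0" using l01 by simp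
    show "0 \<in> Q'" unfolding Q'_def using w0 WQ by (intro image_eqI[of _ _ w0]) (auto simp: b_def)
    show "vector [l1 - l0, 0] \<in> Q'" unfolding Q'_def
      using w1 WQ W2[OF w1(1)] by (intro image_eqI[of _ _ w1]) (auto simp: vec_eq_2 vector_2 b12)
    show "x $ 2 \<ge> 0" if "x \<in> Q'" for x using that g(4) by (auto simp: Q'_def b12)
    show "0 \<le> x $ 1 \<and> x $ 1 \<le> l1 - l0" if "x \<in> Q'" "x $ 2 = 0" for x
      using that g(5) lF by (auto simp: Q'_def b12)
  qed
  then show ?thesis
  proof
    assume "width_one Q'"
    then show ?thesis using width_one_pullback lattice_autD[OF g(1)] b unfolding Q'_def by blast
  qed (use equiv equiv_unimodular_trans in blast)
qed

subsection \<open>Deep lattice points of polygons\<close>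

text \<open>An affinely invariant measure of how far inside \<open>Q\<close> the point
  \<open>w\<close> lies. If \<open>Q\<close> is a projection of a convex set, a segment over
  \<open>x\<close> along the fibre and a point over \<open>y\<close> yield a segment over
  \<open>w\<close> of at least \<open>c\<close> times the length.\<close>

definition deep :: "real \<Rightarrow> 'a::real_normed_vector \<Rightarrow> 'a set \<Rightarrow> bool"
  where "deep c w Q \<longleftrightarrow> (\<forall>x\<in>Q. \<exists>y\<in>Q. \<exists>t. c \<le> t \<and> t \<le> 1 \<and> w = t *\<^sub>R x + (1 - t) *\<^sub>R y)"

lemma deep_mono: "deep c w Q \<Longrightarrow> c' \<le> c \<Longrightarrow> deep c' w Q"
  unfolding deep_def by (meson order_trans)

lemma deep_affine_image:
  assumes "deep c w Q" "linear g"
  shows "deep c (g w + b) ((\<lambda>x. g x + b) ` Q)"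
  unfolding deep_def ball_simps
proof
  fix x assume "x \<in> Q"
  then obtain y t where y: "y \<in> Q" "c \<le> t" "t \<le> 1" "w = t *\<^sub>R x + (1 - t) *\<^sub>R y"
    using assms(1) unfolding deep_def by blast
  have "g w = t *\<^sub>R g x + (1 - t) *\<^sub>R g y"
    unfolding y(4) by (simp only: linear_add[OF assms(2)] linear_scale[OF assms(2)])
  then have "g w + b = t *\<^sub>R (g x + b) + (1 - t) *\<^sub>R (g y + b)" by (simp add: algebra_simps)
  then show "\<exists>y\<in>(\<lambda>x. g x + b) ` Q. \<exists>t\<ge>c. t \<le> 1 \<and> g w + b = t *\<^sub>R (g x + b) + (1 - t) *\<^sub>R y"
    using y by blast
qed

text \<open>The point \<open>x\<close> is reflected in \<open>w\<close> and the distance scaled by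
  \<open>s\<close>. As \<open>D\<close> bounds the distance from \<open>w\<close> to points of
  \<open>Q\<close>, the result \<open>y\<close> stays in the ball of radius \<open>e = s * D\<close>
  around \<open>w\<close>. Solving for \<open>w\<close> gives the weight
  \<open>s / (1 + s)\<close>.\<close>

lemma interior_imp_deep:
  assumes "w \<in> interior Q" "bounded Q"
  obtains c where "c > 0" "deep c w Q"
proof -
  obtain e where e: "e > 0" "cball w e \<subseteq> Q" using assms(1) mem_interior_cball by blast
  obtain B where B: "\<And>x. x \<in> Q \<Longrightarrow> norm x \<le> B" using assms(2) bounded_iff by blast
  define D where "D = norm w + \<bar>B\<bar> + 1"
  have D: "D > 0" unfolding D_def by (smt (verit) norm_ge_zero)
  define s where "s = e / D"
  have s: "s > 0" using e D by (simp add: s_def)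
  have "deep (s / (1 + s)) w Q"
    unfolding deep_def
  proof
    fix x assume x: "x \<in> Q"
    define y where "y = w + s *\<^sub>R (w - x)"
    have "norm (w - x) \<le> D"
      using norm_triangle_ineq4[of w x] B[OF x] by (simp add: D_def)
    then have "s * norm (w - x) \<le> s * D" using s by (intro mult_left_mono) auto
    also have "\<dots> = e" using D by (simp add: s_def)
    finally have "y \<in> cball w e" using s by (simp add: y_def dist_norm)
    then have "y \<in> Q" using e by blast
    have "(1 + s) *\<^sub>R w = s *\<^sub>R x + y" by (simp add: y_def algebra_simps)
    then have "w = (1 / (1 + s)) *\<^sub>R (s *\<^sub>R x + y)" using s
      by (metis add_pos_pos divide_self_if less_numeral_extra(1,3) scaleR_one scaleR_scaleR times_divide_eq_left mult_1)
    also have "\<dots> = (s / (1 + s)) *\<^sub>R x + (1 / (1 + s)) *\<^sub>R y" by (simp add: scaleR_add_right)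
    also have "1 / (1 + s) = 1 - s / (1 + s)" using s by (simp add: field_simps)
    finally show "\<exists>y\<in>Q. \<exists>t\<ge>s / (1 + s). t \<le> 1 \<and> w = t *\<^sub>R x + (1 - t) *\<^sub>R y"
      using \<open>y \<in> Q\<close> s by (intro bexI[of _ y] exI[of _ "s / (1 + s)"]) auto
  qed
  then show ?thesis using that s by (metis add_pos_pos divide_pos_pos zero_less_one)
qed

section \<open>Deep points of polygons that contain a long segment\<close>

lemma line_section:
  fixes Q :: "'a::real_normed_vector set"
  assumes "compact Q" "v \<noteq> 0" "q + s0 *\<^sub>R v \<in> Q"
  obtains \<sigma>0 \<sigma>1 :: real where "q + \<sigma>0 *\<^sub>R v \<in> Q" "q + \<sigma>1 *\<^sub>R v \<in> Q"
    "\<And>\<sigma>. q + \<sigma> *\<^sub>R v \<in> Q \<Longrightarrow> \<sigma>0 \<le> \<sigma> \<and> \<sigma> \<le> \<sigma>1"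
proof -
  define I where "I = {\<sigma>. q + \<sigma> *\<^sub>R v \<in> Q}"
  have "closed ((\<lambda>\<sigma>. q + \<sigma> *\<^sub>R v) -` Q)"
    using compact_imp_closed[OF assms(1)] by (intro closed_vimage continuous_intros)
  moreover have "bounded I"
  proof -
    obtain B where B: "\<And>x. x \<in> Q \<Longrightarrow> norm x \<le> B"
      using compact_imp_bounded[OF assms(1)] bounded_iff by blast
    have "norm \<sigma> \<le> (B + norm q) / norm v" if "\<sigma> \<in> I" for \<sigma>
    proof -
      have "norm (\<sigma> *\<^sub>R v) \<le> norm (q + \<sigma> *\<^sub>R v) + norm q"
        using norm_triangle_ineq4[of "q + \<sigma> *\<^sub>R v" q] by simp
      also have "\<dots> \<le> B + norm q" using B that by (simp add: I_def)
      finally show ?thesis using assms(2) by (simp add: field_simps)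
    qed
    then show ?thesis unfolding bounded_iff by blast
  qed
  ultimately have c: "compact I" by (auto simp: compact_eq_bounded_closed I_def vimage_def)
  have ne: "I \<noteq> {}" using assms(3) by (auto simp: I_def)
  obtain \<sigma>0 where "\<sigma>0 \<in> I" "\<forall>t\<in>I. \<sigma>0 \<le> t" using compact_attains_inf[OF c ne] by blast
  moreover obtain \<sigma>1 where "\<sigma>1 \<in> I" "\<forall>t\<in>I. t \<le> \<sigma>1" using compact_attains_sup[OF c ne] by blast
  ultimately show ?thesis using that[of \<sigma>0 \<sigma>1] by (auto simp: I_def)
qed

text \<open>The midpoint, rounded down, works; the worst case is length three, which is split into
  one and two.\<close>

lemma Ints_middle_third:
  fixes a b :: real
  assumes "a \<in> \<int>" "b \<in> \<int>" "a + 1 < b"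
  obtains k where "k \<in> \<int>" "(b - a) / 3 \<le> k - a" "(b - a) / 3 \<le> b - k"
proof -
  from assms obtain n m where nm: "a = real_of_int n" "b = real_of_int m" by (auto elim!: Ints_cases)
  define k where "k = n + (m - n) div 2"
  have "n + 1 < m" using assms(3) unfolding nm by linarith
  then have "m - n \<le> 3 * (k - n)" "m - n \<le> 3 * (m - k)" unfolding k_def by presburger+
  then have "real_of_int (m - n) \<le> real_of_int (3 * (k - n))"
    "real_of_int (m - n) \<le> real_of_int (3 * (m - k))" by (simp_all only: of_int_le_iff)
  then show ?thesis using that[of "real_of_int k"] by (simp add: nm)
qed

text \<open>Along \<open>v\<close> the polygon projects to an interval from \<open>a\<close> to
  \<open>b\<close> with integral ends. If this is longer than one, it has an integer
  \<open>k\<close> in its middle third. The fibre over \<open>k\<close> has length at least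
  \<open>9 / 3 = 3\<close> in units of \<open>v\<close>, so its middle third contains a lattice
  point. Each of the two choices costs a factor of one third, whence \<open>1 / 9\<close>.\<close>

lemma polygon_long_segment:
  fixes Q :: "(real^2) set"
  assumes Q: "lattice_polytope Q" and ls: "long_segment 9 Q"
  shows "width_one Q \<or> (\<exists>w\<in>integer_lattice. deep (1 / 9) w Q)"
proof -
  from Q obtain V where V: "finite V" "V \<noteq> {}" "V \<subseteq> integer_lattice" "Q = convex hull V" "V \<subseteq> Q"
    by (rule lattice_polytopeE)
  have cQ: "convex Q" "compact Q" using Q lattice_polytopeD by auto
  from ls obtain x0 v where x0: "x0 \<in> Q" "x0 + 9 *\<^sub>R v \<in> Q" and v: "v \<in> integer_lattice" "v \<noteq> 0"
    unfolding long_segment_def by auto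
  obtain g r where g: "lattice_aut g" "r \<in> \<int>" "r > 0" "g v = r *\<^sub>R axis 2 1"
    using lattice_aut_to_axis[OF v] .
  have lg: "linear g" using g(1) by (rule lattice_autD)
  define \<phi> where "\<phi> x = g x $ 1" for x
  have lin: "linear \<phi>" unfolding \<phi>_def
    by (auto intro!: linearI simp: linear_add[OF lg] linear_scale[OF lg])
  have surj: "\<phi> ` integer_lattice = \<int>"
  proof -
    have "\<phi> ` integer_lattice = (\<lambda>x. x $ 1) ` g ` integer_lattice" by (auto simp: \<phi>_def)
    also have "\<dots> = (\<lambda>x :: real^2. x $ 1) ` integer_lattice" using lattice_autD(5)[OF g(1)] by simp
    also have "\<dots> = \<int>"
      by (auto simp: integer_lattice_2 image_iff intro!: bexI[of _ "vector [_, 0]"])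
    finally show ?thesis .
  qed
  have lc: "\<phi> (\<mu> *\<^sub>R x + (1 - \<mu>) *\<^sub>R z) = \<mu> * \<phi> x + (1 - \<mu>) * \<phi> z" for \<mu> x z
    by (simp add: linear_add[OF lin] linear_scale[OF lin])
  have ker: "\<exists>s. y = x + s *\<^sub>R v" if "\<phi> x = \<phi> y" for x y
  proof -
    have "g (y - x) = (g (y - x) $ 2 / r) *\<^sub>R g v"
      using that g(3) by (simp add: g(4) vec_eq_2 axis_def \<phi>_def linear_diff[OF lg])
    then have "g (y - x) = g ((g (y - x) $ 2 / r) *\<^sub>R v)" by (simp only: linear_scale[OF lg])
    then have "y - x = (g (y - x) $ 2 / r) *\<^sub>R v" by (rule injD[OF lattice_autD(3)[OF g(1)]])
    then show ?thesis by (metis add.commute diff_add_cancel)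
  qed
  define a where "a = Min (\<phi> ` V)"
  define b where "b = Max (\<phi> ` V)"
  have "a \<in> \<phi> ` V" unfolding a_def by (intro Min_in) (use V in auto)
  then obtain pa where pa: "pa \<in> V" "\<phi> pa = a" by auto
  have "b \<in> \<phi> ` V" unfolding b_def by (intro Max_in) (use V in auto)
  then obtain pb where pb: "pb \<in> V" "\<phi> pb = b" by auto
  have abV: "a \<le> \<phi> x" "\<phi> x \<le> b" if "x \<in> V" for x using that V(1) by (auto simp: a_def b_def)
  have abI: "a \<in> \<int>" "b \<in> \<int>" using pa pb V(3) surj by blast+
  have ab: "a \<le> \<phi> x \<and> \<phi> x \<le> b" if "x \<in> Q" for x
  proof -
    have "convex (\<phi> -` {a..b})" using lin by (intro convex_linear_vimage) auto
    moreover have "V \<subseteq> \<phi> -` {a..b}" using abV by auto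
    ultimately have "Q \<subseteq> \<phi> -` {a..b}" unfolding V(4) by (intro hull_minimal)
    then show ?thesis using that by auto
  qed
  show ?thesis
  proof (cases "b \<le> a + 1")
    case True
    then have "width_one Q"
      using lin surj abI ab unfolding width_one_def by (intro exI[of _ \<phi>] exI[of _ a]) fastforce
    then show ?thesis ..
  next
    case False
    then obtain k where k: "k \<in> \<int>" "(b - a) / 3 \<le> k - a" "(b - a) / 3 \<le> b - k"
      using Ints_middle_third[OF abI] by (metis not_le)
    \<comment> \<open>The fibre over \<open>k\<close> is reached from \<open>x\<close> by moving
      towards an extreme vertex on the other side; as \<open>k\<close> is in the middle third,
      \<open>x\<close> keeps a weight of at least one third.\<close>
    have cross: "\<exists>z\<in>Q. \<exists>\<mu>. 1 / 3 \<le> \<mu> \<and> \<mu> \<le> 1 \<and> \<phi> (\<mu> *\<^sub>R x + (1 - \<mu>) *\<^sub>R z) = k" if x: "x \<in> Q" for x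
    proof (cases "\<phi> x \<le> k")
      case True
      define \<mu> where "\<mu> = (b - k) / (b - \<phi> x)"
      have bk: "b - k > 0" "b - \<phi> x > 0" using True k(2,3) False by (auto simp: field_simps)
      have "(b - \<phi> x) / 3 \<le> b - k" using k(3) ab[OF x, THEN conjunct1] by argo
      then have "1 / 3 \<le> \<mu>" "\<mu> \<le> 1" using bk True by (auto simp: \<mu>_def field_simps)
      moreover have "\<mu> * (b - \<phi> x) = b - k" using bk by (simp add: \<mu>_def)
      then have "\<phi> (\<mu> *\<^sub>R x + (1 - \<mu>) *\<^sub>R pb) = k"
        unfolding lc pb(2) by (simp add: algebra_simps)
      ultimately show ?thesis using pb V(5) by blast
    next
      case xk: False
      define \<mu> where "\<mu> = (k - a) / (\<phi> x - a)"
      have bk: "k - a > 0" "\<phi> x - a > 0" using xk k(2,3) False by (auto simp: field_simps)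
      have "(\<phi> x - a) / 3 \<le> k - a" using k(2) ab[OF x, THEN conjunct2] by argo
      then have "1 / 3 \<le> \<mu>" "\<mu> \<le> 1" using bk xk by (auto simp: \<mu>_def field_simps)
      moreover have "\<mu> * (\<phi> x - a) = k - a" using bk by (simp add: \<mu>_def)
      then have "\<phi> (\<mu> *\<^sub>R x + (1 - \<mu>) *\<^sub>R pa) = k"
        unfolding lc pa(2) by (simp add: algebra_simps)
      ultimately show ?thesis using pa V(5) by blast
    qed
    obtain z0 \<mu>0 where z0: "z0 \<in> Q" "1 / 3 \<le> \<mu>0" "\<mu>0 \<le> 1" "\<phi> (\<mu>0 *\<^sub>R x0 + (1 - \<mu>0) *\<^sub>R z0) = k"
      using cross[OF x0(1)] by blast
    define q where "q = \<mu>0 *\<^sub>R x0 + (1 - \<mu>0) *\<^sub>R z0"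
    have q0: "q + 0 *\<^sub>R v \<in> Q" using convexD[OF cQ(1) x0(1) z0(1), of \<mu>0 "1 - \<mu>0"] z0 by (simp add: q_def)
    have "q + (9 * \<mu>0) *\<^sub>R v = \<mu>0 *\<^sub>R (x0 + 9 *\<^sub>R v) + (1 - \<mu>0) *\<^sub>R z0"
      by (simp add: q_def algebra_simps)
    then have q1: "q + (9 * \<mu>0) *\<^sub>R v \<in> Q"
      using convexD[OF cQ(1) x0(2) z0(1), of \<mu>0 "1 - \<mu>0"] z0 by simp
    obtain \<sigma>0 \<sigma>1 where \<sigma>: "q + \<sigma>0 *\<^sub>R v \<in> Q" "q + \<sigma>1 *\<^sub>R v \<in> Q"
        "\<And>\<sigma>. q + \<sigma> *\<^sub>R v \<in> Q \<Longrightarrow> \<sigma>0 \<le> \<sigma> \<and> \<sigma> \<le> \<sigma>1"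
      using line_section[OF cQ(2) v(2) q0] by blast
    have len: "\<sigma>1 - \<sigma>0 \<ge> 3" using \<sigma>(3)[OF q0] \<sigma>(3)[OF q1] z0(2) by linarith
    have mem: "q + \<tau> *\<^sub>R v \<in> Q" if "\<sigma>0 \<le> \<tau>" "\<tau> \<le> \<sigma>1" for \<tau>
    proof -
      define t where "t = (\<tau> - \<sigma>0) / (\<sigma>1 - \<sigma>0)"
      have t: "0 \<le> t" "t \<le> 1" using that len by (auto simp: t_def field_simps)
      have "t * (\<sigma>1 - \<sigma>0) = \<tau> - \<sigma>0" using len by (simp add: t_def)
      then have \<tau>: "\<tau> = (1 - t) * \<sigma>0 + t * \<sigma>1" by (simp add: algebra_simps)
      have "q + \<tau> *\<^sub>R v = (1 - t) *\<^sub>R (q + \<sigma>0 *\<^sub>R v) + t *\<^sub>R (q + \<sigma>1 *\<^sub>R v)"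
        unfolding \<tau> by (simp add: algebra_simps)
      then show ?thesis using convexD_alt[OF cQ(1) \<sigma>(1,2) t] by simp
    qed
    obtain l where l: "l \<in> integer_lattice" "\<phi> l = k" using k(1) surj by (metis imageE)
    then obtain s where s: "l = q + s *\<^sub>R v" using ker[of q l] z0(4) by (auto simp: q_def)
    \<comment> \<open>The first point of the form \<open>l + j v\<close> that is not in the lower
      third. It overshoots by at most one, which the middle third accommodates because the fibre has
      length at least 3.\<close>
    define j where "j = real_of_int \<lceil>\<sigma>0 + (\<sigma>1 - \<sigma>0) / 3 - s\<rceil>"
    define \<sigma>w where "\<sigma>w = s + j"
    have "\<sigma>0 + (\<sigma>1 - \<sigma>0) / 3 \<le> \<sigma>w" "\<sigma>w \<le> \<sigma>0 + (\<sigma>1 - \<sigma>0) / 3 + 1"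
      unfolding \<sigma>w_def j_def by linarith+
    then have \<sigma>w: "\<sigma>0 + (\<sigma>1 - \<sigma>0) / 3 \<le> \<sigma>w" "\<sigma>w \<le> \<sigma>1 - (\<sigma>1 - \<sigma>0) / 3"
      using len by argo+
    define w where "w = q + \<sigma>w *\<^sub>R v"
    have "w = l + j *\<^sub>R v" by (simp add: w_def s \<sigma>w_def algebra_simps)
    then have wI: "w \<in> integer_lattice"
      using l(1) v(1) by (auto simp: j_def intro!: integer_lattice_intros)
    have "deep (1 / 9) w Q"
      unfolding deep_def
    proof
      fix x assume x: "x \<in> Q"
      obtain z \<mu> where z: "z \<in> Q" "1 / 3 \<le> \<mu>" "\<mu> \<le> 1" "\<phi> (\<mu> *\<^sub>R x + (1 - \<mu>) *\<^sub>R z) = k"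
        using cross[OF x] by blast
      define u where "u = \<mu> *\<^sub>R x + (1 - \<mu>) *\<^sub>R z"
      have uQ: "u \<in> Q" using convexD[OF cQ(1) x z(1), of \<mu> "1 - \<mu>"] z by (simp add: u_def)
      obtain \<tau> where \<tau>: "u = q + \<tau> *\<^sub>R v" using ker[of q u] z0(4) z(4) by (auto simp: q_def u_def)
      have \<tau>b: "\<sigma>0 \<le> \<tau>" "\<tau> \<le> \<sigma>1" using \<sigma>(3) uQ \<tau> by auto
      \<comment> \<open>The point beyond \<open>\<sigma>w\<close> as seen from
        \<open>\<tau>\<close>, at half the distance. It stays in the fibre because
        \<open>\<sigma>w\<close> keeps a third of the length from both ends.\<close>
      define \<tau>' where "\<tau>' = \<sigma>w + (\<sigma>w - \<tau>) / 2"
      have \<tau>': "\<sigma>0 \<le> \<tau>'" "\<tau>' \<le> \<sigma>1" "3 * \<sigma>w = 2 * \<tau>' + \<tau>"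
        unfolding \<tau>'_def using \<sigma>w \<tau>b by argo+
      define u' where "u' = q + \<tau>' *\<^sub>R v"
      have u'Q: "u' \<in> Q" unfolding u'_def using \<tau>' by (intro mem)
      \<comment> \<open>From \<open>3 w = 2 u' + u\<close> and
        \<open>u = \<mu> x + (1 - \<mu>) z\<close>, the points \<open>u'\<close> and
        \<open>z\<close> are merged into a single \<open>y\<close> of total weight \<open>m\<close>.
        The weight of \<open>x\<close> in \<open>w\<close> is then \<open>\<mu> / 3\<close>.\<close>
      define m where "m = 3 - \<mu>"
      have m: "m > 0" "2 + (1 - \<mu>) = m" using z(3) by (auto simp: m_def)
      define y where "y = (2 / m) *\<^sub>R u' + ((1 - \<mu>) / m) *\<^sub>R z"
      have "2 / m + (1 - \<mu>) / m = (2 + (1 - \<mu>)) / m" by (rule add_divide_distrib[symmetric])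
      then have "2 / m + (1 - \<mu>) / m = 1" using m by simp
      then have yQ: "y \<in> Q"
        unfolding y_def using u'Q z m(1) by (intro convexD[OF cQ(1)]) auto
      have "m *\<^sub>R y = 2 *\<^sub>R u' + (1 - \<mu>) *\<^sub>R z"
        using m(1) by (simp add: y_def scaleR_add_right)
      then have "(3 - \<mu>) *\<^sub>R y = 2 *\<^sub>R u' + (1 - \<mu>) *\<^sub>R z" by (simp add: m_def)
      moreover have "3 *\<^sub>R w = 3 *\<^sub>R q + (2 * \<tau>' + \<tau>) *\<^sub>R v"
        by (simp add: w_def scaleR_add_right flip: \<tau>'(3))
      then have "3 *\<^sub>R w = 2 *\<^sub>R u' + u"
        using scaleR_left_distrib[of 2 1 q] by (simp add: u'_def \<tau> algebra_simps)
      ultimately have "3 *\<^sub>R w = \<mu> *\<^sub>R x + (3 - \<mu>) *\<^sub>R y" by (simp add: u_def)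
      then have "(1 / 3) *\<^sub>R 3 *\<^sub>R w = (\<mu> / 3) *\<^sub>R x + ((3 - \<mu>) / 3) *\<^sub>R y"
        by (simp only: scaleR_add_right scaleR_scaleR) simp
      moreover have "(3 - \<mu>) / 3 = 1 - \<mu> / 3" by argo
      ultimately have "w = (\<mu> / 3) *\<^sub>R x + (1 - \<mu> / 3) *\<^sub>R y" by simp
      then show "\<exists>y\<in>Q. \<exists>t\<ge>1 / 9. t \<le> 1 \<and> w = t *\<^sub>R x + (1 - t) *\<^sub>R y"
        using yQ z by (intro bexI[of _ y] exI[of _ "\<mu> / 3"]) auto
    qed
    then show ?thesis using wI by blast
  qed
qed

lemma finite_uniform_positive:
  fixes R :: "'a \<Rightarrow> real \<Rightarrow> bool"
  assumes "finite A" "\<And>X. X \<in> A \<Longrightarrow> \<exists>c>0. R X c" "\<And>X c c'. R X c \<Longrightarrow> c' \<le> c \<Longrightarrow> R X c'"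
  shows "\<exists>c>0. \<forall>X\<in>A. R X c"
  using assms(1,2)
proof (induction A)
  case empty
  then show ?case by (intro exI[of _ 1]) auto
next
  case (insert X A)
  then obtain c d where "c > 0" "\<forall>X\<in>A. R X c" "d > 0" "R X d" by blast
  then show ?case by (intro exI[of _ "min c d"]) (auto intro: assms(3))
qed

text \<open>A segment of length 9 gives depth \<open>1 / 9\<close> or width one. The polygons
  without one form finitely many classes, and depth is constant on a class, so a minimum over the
  classes gives a uniform constant.\<close>

lemma polygon_trichotomy:
  obtains c where "c > 0" "\<And>Q :: (real^2) set. lattice_polytope Q \<Longrightarrow> nondegenerate Q \<Longrightarrow>
    width_one Q \<or> Q \<cong>\<^sub>\<int> double_unimodular_2_simplex \<or> (\<exists>w\<in>integer_lattice. deep c w Q)"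
proof -
  define R where "R = {(P :: (real^2) set, Q). P \<cong>\<^sub>\<int> Q}"
  define S where "S = {Q :: (real^2) set. lattice_polytope Q \<and> nondegenerate Q \<and> \<not> long_segment (real 9) Q}"
  \<comment> \<open>By \<open>hollow_polygon\<close>, every polygon in \<open>S'\<close> has an
    interior lattice point, which is deep for some constant.\<close>
  define S' where "S' = {Q \<in> S. \<not> width_one Q \<and> \<not> Q \<cong>\<^sub>\<int> double_unimodular_2_simplex}"
  have "finite (S // R)" unfolding S_def R_def by (rule finite_classes_no_long_segment) simp
  moreover have "S' // R \<subseteq> S // R" by (auto simp: S'_def quotient_def)
  ultimately have fin: "finite (S' // R)" by (rule rev_finite_subset)
  have "\<exists>c>0. \<forall>X\<in>S' // R. \<forall>Q\<in>X. \<exists>w\<in>integer_lattice. deep c w Q"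
  proof (rule finite_uniform_positive[OF fin])
    fix X assume "X \<in> S' // R"
    then obtain Q0 where Q0: "Q0 \<in> S'" "X = R `` {Q0}" by (rule quotientE)
    then have Q0': "lattice_polytope Q0" "nondegenerate Q0" "\<not> width_one Q0"
      "\<not> Q0 \<cong>\<^sub>\<int> double_unimodular_2_simplex" by (auto simp: S'_def S_def)
    then obtain w where w: "w \<in> interior Q0" "w \<in> integer_lattice" using hollow_polygon by blast
    obtain c where c: "c > 0" "deep c w Q0"
      using interior_imp_deep[OF w(1) lattice_polytopeD(4)[OF Q0'(1)]] .
    have "\<exists>w\<in>integer_lattice. deep c w Q" if "Q \<in> X" for Q
    proof -
      have "Q0 \<cong>\<^sub>\<int> Q" using that by (auto simp: Q0(2) R_def)
      then obtain f where f: "affine_unimodular f" "f ` Q0 = Q" unfolding unimodular_equiv_def by blast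
      obtain g b where g: "lattice_aut g" "b \<in> integer_lattice" "f = (\<lambda>x. g x + b)"
        using affine_unimodularE[OF f(1)] .
      have "deep c (g w + b) Q" using deep_affine_image[OF c(2) lattice_autD(1)[OF g(1)], of b] f(2) g(3) by simp
      then show ?thesis using integer_lattice_add[OF lattice_autD(6)[OF g(1) w(2)] g(2)] by blast
    qed
    then show "\<exists>c>0. \<forall>Q\<in>X. \<exists>w\<in>integer_lattice. deep c w Q" using c(1) by blast
  qed (blast intro: deep_mono)
  then obtain c where c: "c > 0" "\<And>X Q. X \<in> S' // R \<Longrightarrow> Q \<in> X \<Longrightarrow> \<exists>w\<in>integer_lattice. deep c w Q"
    by blast
  show ?thesis
  proof (rule that[of "min c (1 / 9)"])
    fix Q :: "(real^2) set" assume Q: "lattice_polytope Q" "nondegenerate Q"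
    show "width_one Q \<or> Q \<cong>\<^sub>\<int> double_unimodular_2_simplex \<or>
      (\<exists>w\<in>integer_lattice. deep (min c (1 / 9)) w Q)"
    proof (cases "long_segment 9 Q")
      case True
      then show ?thesis using polygon_long_segment[OF Q(1) True] deep_mono[OF _ min.cobounded2] by blast
    next
      case False
      show ?thesis
      proof (cases "Q \<in> S'")
        case True
        have "R `` {Q} \<in> S' // R" using True by (rule quotientI)
        moreover have "Q \<in> R `` {Q}"
          using equiv_class_self[OF equiv_unimodular, of Q] by (simp add: R_def)
        ultimately show ?thesis using c(2) deep_mono[OF _ min.cobounded1] by blast
      next
        case False
        then show ?thesis using \<open>\<not> long_segment 9 Q\<close> Q by (auto simp: S'_def S_def)
      qed
    qed
  qed (use c(1) in auto)
qed

subsection \<open>Dimension three\<close>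

lemma vec_eq_3: "(x::real^3) = y \<longleftrightarrow> x $ 1 = y $ 1 \<and> x $ 2 = y $ 2 \<and> x $ 3 = y $ 3"
  by (simp add: vec_eq_iff forall_3)

lemma integer_lattice_3:
  "(x::real^3) \<in> integer_lattice \<longleftrightarrow> x $ 1 \<in> \<int> \<and> x $ 2 \<in> \<int> \<and> x $ 3 \<in> \<int>"
  by (simp add: integer_lattice_def forall_3)

text \<open>A lattice vector with value 1 is primitive, so it can be moved to the first unit vector.
  The transported functional \<open>\<psi>\<close> then has value 1 there, and a shear in this
  direction replaces the first coordinate by \<open>\<psi>\<close>.\<close>

lemma lattice_aut_with_first_coordinate:
  fixes \<phi> :: "real^3 \<Rightarrow> real"
  assumes \<phi>: "linear \<phi>" "\<phi> ` integer_lattice = \<int>"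
  obtains h where "lattice_aut h" "\<And>x. h x $ 1 = \<phi> x"
proof -
  have "1 \<in> \<phi> ` integer_lattice" using \<phi>(2) by simp
  then obtain v where v: "v \<in> integer_lattice" "\<phi> v = 1" by auto
  have "v \<noteq> 0" using v(2) linear_0[OF \<phi>(1)] by auto
  then obtain g r where g: "lattice_aut g" "r \<in> \<int>" "r > 0" "g v = r *\<^sub>R axis 1 1"
    by (rule lattice_aut_to_axis[OF v(1)])
  define \<psi> where "\<psi> = \<phi> \<circ> inv g"
  have lin: "linear \<psi>"
    unfolding \<psi>_def using lattice_autD(1)[OF lattice_aut_inv[OF g(1)]] \<phi>(1) by (rule linear_compose)
  have \<psi>I: "\<psi> x \<in> \<int>" if "x \<in> integer_lattice" for x
    using lattice_autD(6)[OF lattice_aut_inv[OF g(1)] that] \<phi>(2) by (auto simp: \<psi>_def)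
  have \<psi>g: "\<psi> (g x) = \<phi> x" for x by (simp add: \<psi>_def inv_f_f lattice_autD(3)[OF g(1)])
  \<comment> \<open>Two positive integers with product 1 are both 1.\<close>
  have r1: "r * \<psi> (axis 1 1) = 1"
    using \<psi>g[of v] v(2) linear_scale[OF lin, of r "axis 1 1"] by (simp add: g(4))
  then have "\<psi> (axis 1 1) > 0" using g(3) by (metis zero_less_mult_pos zero_less_one)
  then have "1 \<le> \<psi> (axis 1 1)" "1 \<le> r"
    using \<psi>I[of "axis 1 1"] g(2,3) Ints_less_iff[of 0] integer_lattice_axis[of 1 1] by auto
  then have e: "\<psi> (axis 1 1) = 1"
    using r1 mult_mono[of 1 r 1 "\<psi> (axis 1 1)"] mult_left_mono[of 1 r "\<psi> (axis 1 1)"] by (auto simp: mult.commute)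
  have "lattice_aut (\<lambda>x. x + (\<psi> x - x $ 1) *\<^sub>R axis 1 1)"
  proof (rule lattice_aut_transvection)
    show "linear (\<lambda>x. \<psi> x - x $ 1)"
      by (auto intro!: linearI simp: linear_add[OF lin] linear_scale[OF lin] algebra_simps)
  qed (use \<psi>I e in \<open>auto simp: integer_lattice_3 axis_def\<close>)
  then have "lattice_aut ((\<lambda>x. x + (\<psi> x - x $ 1) *\<^sub>R axis 1 1) \<circ> g)"
    using g(1) by (rule lattice_aut_comp)
  then show ?thesis by (rule that) (simp add: \<psi>g axis_def)
qed

text \<open>With the width functional as first coordinate, all generators have height 0 or 1. The
  two layers are the Cayley factors for \<open>r = 2\<close>; neither is empty because the polytope
  is full-dimensional.\<close>

lemma width_one_imp_cayley:
  fixes P :: "(real^3) set"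
  assumes P: "lattice_polytope P" "nondegenerate P" and w: "width_one P"
  shows "cayley_polytope P"
proof -
  from w obtain \<phi> k where \<phi>: "linear \<phi>" "\<phi> ` integer_lattice = \<int>" "k \<in> \<int>"
    "\<And>x. x \<in> P \<Longrightarrow> k \<le> \<phi> x \<and> \<phi> x \<le> k + (1::real)"
    unfolding width_one_def by auto
  obtain h where h: "lattice_aut h" "\<And>x. h x $ 1 = \<phi> x"
    using lattice_aut_with_first_coordinate[OF \<phi>(1,2)] by blast
  define b :: "real^3" where "b = - k *\<^sub>R axis 1 1"
  have b: "b \<in> integer_lattice" unfolding b_def using \<phi>(3) by (auto intro!: integer_lattice_intros)
  define P' where "P' = (\<lambda>x. h x + b) ` P"
  have equiv: "P \<cong>\<^sub>\<int> P'" using h(1) b by (rule unimodular_equivI) (simp add: P'_def)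
  have latP': "lattice_polytope P'" unfolding P'_def
    using P(1) lattice_autD(1)[OF h(1)] b lattice_autD(6)[OF h(1)] by (rule lattice_polytope_affine_image)
  have nd: "nondegenerate P'" unfolding P'_def
    using P(2) lattice_autD(1,4)[OF h(1)] by (rule nondegenerate_affine_image)
  from latP' obtain V where V: "finite V" "V \<noteq> {}" "V \<subseteq> integer_lattice" "P' = convex hull V" "V \<subseteq> P'"
    by (rule lattice_polytopeE)
  have V01: "v $ 1 = 0 \<or> v $ 1 = 1" if "v \<in> V" for v
  proof -
    obtain x where x: "x \<in> P" "v = h x + b" using \<open>v \<in> V\<close> V(5) by (auto simp: P'_def)
    have "0 \<le> v $ 1" "v $ 1 \<le> 1" using \<phi>(4)[OF x(1)] by (auto simp: x(2) h(2) b_def axis_def)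
    moreover have "v $ 1 \<in> \<int>" using V(3) that integer_lattice_3 by blast
    ultimately show ?thesis using Ints_less_iff[of 0 "v $ 1"] by fastforce
  qed
  have not_const: "\<not> (\<forall>v\<in>V. v $ 1 = d)" for d
  proof
    assume "\<forall>v\<in>V. v $ 1 = d"
    then have "V \<subseteq> {x. axis 1 1 \<bullet> x = d}" by (auto simp: inner_axis')
    then have "P' \<subseteq> {x. axis 1 1 \<bullet> x = d}"
      unfolding V(4) by (intro hull_minimal convex_hyperplane)
    then have "axis 1 1 = (0 :: real^3)" using nd unfolding nondegenerate_def by blast
    then show False by (simp add: axis_eq_0_iff)
  qed
  define V0 where "V0 = {v \<in> V. v $ 1 = 0}"
  define V1 where "V1 = {v \<in> V. v $ 1 = 1}"
  have ne: "V0 \<noteq> {}" "V1 \<noteq> {}" using not_const[of 1] not_const[of 0] V01 by (auto simp: V0_def V1_def)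
  have e1: "std_basis 1 = (axis 1 1 :: real^3)" "std_basis 2 = (axis 2 1 :: real^3)"
    "std_basis 3 = (axis 3 1 :: real^3)" by (simp_all add: std_basis_def)
  define V1' where "V1' = (\<lambda>v. v - axis 1 1) ` V1"
  define F where "F i = convex hull (if i = 0 then V0 else V1')" for i :: nat
  have I: "{2..CARD(3)} = {2, 3}" by auto
  have "x \<in> span (std_basis ` {2..CARD(3)})" if "x $ 1 = 0" for x :: "real^3"
  proof -
    have x: "x = x $ 2 *\<^sub>R std_basis 2 + x $ 3 *\<^sub>R std_basis 3"
      unfolding e1 using that by (simp add: vec_eq_3 axis_def)
    have "x $ 2 *\<^sub>R std_basis 2 + x $ 3 *\<^sub>R std_basis 3 \<in> span (std_basis ` {2, 3})"
      by (intro span_add span_scale span_base) auto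
    then show ?thesis unfolding I using x by metis
  qed
  then have sp: "F i \<subseteq> span (std_basis ` {2..CARD(3)})" for i
    unfolding F_def by (intro hull_minimal subspace_imp_convex subspace_span)
      (auto simp: V0_def V1'_def V1_def axis_def)
  have latF: "lattice_polytope (F i)" for i
    unfolding lattice_polytope_iff F_def using V(1,3) ne
    by (intro exI[of _ "if i = 0 then V0 else V1'"])
      (auto simp: V0_def V1'_def V1_def intro!: integer_lattice_diff integer_lattice_axis)
  have "(+) (axis 1 1) ` V1' = V1" by (simp add: V1'_def image_image)
  then have "(+) (axis 1 1) ` F 1 = convex hull V1"
    using convex_hull_translation[of "axis 1 1" V1'] by (simp add: F_def)
  moreover have "{1..<2::nat} = {1}" by auto
  ultimately have "F 0 \<union> (\<Union>i\<in>{1..<2}. (+) (std_basis i) ` F i) = convex hull V0 \<union> convex hull V1"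
    by (simp only: UN_insert UN_empty Un_empty_right e1) (simp add: F_def)
  then have "convex hull (F 0 \<union> (\<Union>i\<in>{1..<2}. (+) (std_basis i) ` F i)) = convex hull (V0 \<union> V1)"
    by (simp add: hull_Un_left[symmetric] hull_Un_right[symmetric])
  also have "V0 \<union> V1 = V" using V01 by (auto simp: V0_def V1_def)
  finally have "P \<cong>\<^sub>\<int> convex hull (F 0 \<union> (\<Union>i\<in>{1..<2}. (+) (std_basis i) ` F i))"
    using equiv V(4) by simp
  then show ?thesis
    unfolding cayley_polytope_def using sp latF by (intro exI[of _ 2] exI[of _ F]) auto
qed

text \<open>After \<open>v\<close> has been moved to the third axis, the third coordinate is
  dropped. The factor \<open>r\<close> may exceed 1, as \<open>v\<close> need not be primitive, but
  the kernel is still the real line through \<open>v\<close>.\<close>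

lemma lattice_projection:
  fixes v :: "real^3"
  assumes "v \<in> integer_lattice" "v \<noteq> 0"
  obtains \<rho> :: "real^3 \<Rightarrow> real^2" where "linear \<rho>" "\<rho> ` integer_lattice = integer_lattice" "surj \<rho>"
    "\<rho> v = 0" "\<And>x y. \<rho> x = \<rho> y \<Longrightarrow> \<exists>s. y = x + s *\<^sub>R v"
proof -
  obtain g r where g: "lattice_aut g" "r \<in> \<int>" "r > 0" "g v = r *\<^sub>R axis 3 1"
    using lattice_aut_to_axis[OF assms] .
  have lg: "linear g" using g(1) by (rule lattice_autD)
  define \<pi> :: "real^3 \<Rightarrow> real^2" where "\<pi> x = vector [x $ 1, x $ 2]" for x
  define \<rho> where "\<rho> = \<pi> \<circ> g"
  have \<pi>: "\<pi> x $ 1 = x $ 1" "\<pi> x $ 2 = x $ 2" for x by (simp_all add: \<pi>_def vector_2)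
  have l\<pi>: "linear \<pi>" by (rule linearI) (auto simp: vec_eq_2 \<pi>)
  have sec: "\<pi> (vector [y $ 1, y $ 2, 0]) = y" for y by (simp add: vec_eq_2 \<pi> vector_3)
  have "\<pi> ` integer_lattice = integer_lattice"
  proof (intro equalityI subsetI)
    fix y :: "real^2" assume "y \<in> integer_lattice"
    then show "y \<in> \<pi> ` integer_lattice"
      using sec[of y] by (intro image_eqI[of _ _ "vector [y $ 1, y $ 2, 0]"])
        (auto simp: integer_lattice_2 integer_lattice_3 vector_3)
  qed (auto simp: integer_lattice_2 integer_lattice_3 \<pi>)
  then have "\<rho> ` integer_lattice = integer_lattice"
    unfolding \<rho>_def image_comp[symmetric] lattice_autD(5)[OF g(1)] .
  moreover have "surj \<pi>" using sec by (rule surjI)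
  then have "surj \<rho>" unfolding \<rho>_def using lattice_autD(4)[OF g(1)] by (intro comp_surj)
  moreover have "linear \<rho>" unfolding \<rho>_def using lg l\<pi> by (rule linear_compose)
  moreover have "\<rho> v = 0" by (simp add: \<rho>_def g(4) vec_eq_2 \<pi> axis_def)
  moreover have "\<exists>s. y = x + s *\<^sub>R v" if "\<rho> x = \<rho> y" for x y
  proof -
    have "g x $ 1 = g y $ 1" "g x $ 2 = g y $ 2" using that \<pi>[of "g x"] \<pi>[of "g y"] by (auto simp: \<rho>_def)
    then have "g (y - x) = (g (y - x) $ 3 / r) *\<^sub>R g v"
      using g(3) by (simp add: g(4) vec_eq_3 axis_def linear_diff[OF lg])
    then have "g (y - x) = g ((g (y - x) $ 3 / r) *\<^sub>R v)" by (simp only: linear_scale[OF lg])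
    then have "y - x = (g (y - x) $ 3 / r) *\<^sub>R v" by (rule injD[OF lattice_autD(3)[OF g(1)]])
    then show ?thesis by (metis add.commute diff_add_cancel)
  qed
  ultimately show ?thesis using that by blast
qed

text \<open>The fibre over a deep lattice point contains a segment of length more than one in the
  direction of \<open>v\<close>, hence a lattice point, which lies in the interior.\<close>

lemma deep_projection_imp_interior_lattice_point:
  fixes P :: "(real^'n) set" and \<rho> :: "real^'n \<Rightarrow> real^'m"
  assumes P: "convex P" "nondegenerate P" and \<rho>: "linear \<rho>" "\<rho> ` integer_lattice = integer_lattice"
    "\<rho> v = 0" "\<And>x y. \<rho> x = \<rho> y \<Longrightarrow> \<exists>s. y = x + s *\<^sub>R v"
    and v: "v \<in> integer_lattice" and x: "x \<in> P" "x + N *\<^sub>R v \<in> P" and N: "c * N > 1" "N > 0" "c > 0"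
    and w: "w \<in> integer_lattice" "deep c w (\<rho> ` P)"
  shows "interior P \<inter> integer_lattice \<noteq> {}"
proof -
  obtain y t where y: "y \<in> P" "c \<le> t" "t \<le> 1" "w = t *\<^sub>R \<rho> x + (1 - t) *\<^sub>R \<rho> y"
    using w(2) x(1) unfolding deep_def by blast
  define q where "q = t *\<^sub>R x + (1 - t) *\<^sub>R y"
  have qw: "\<rho> q = w" by (simp add: q_def y(4) linear_add[OF \<rho>(1)] linear_scale[OF \<rho>(1)])
  have t0: "t > 0" using N(3) y(2) by simp
  have q0: "q \<in> P" unfolding q_def using convexD[OF P(1) x(1) y(1)] t0 y(3) by simp
  have "q + (t * N) *\<^sub>R v = t *\<^sub>R (x + N *\<^sub>R v) + (1 - t) *\<^sub>R y" by (simp add: q_def algebra_simps)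
  then have q1: "q + (t * N) *\<^sub>R v \<in> P" using convexD[OF P(1) x(2) y(1)] t0 y(3) by simp
  have tN: "t * N > 1" using N(1,2) y(2) mult_right_mono[of c t N] by linarith
  obtain l where l: "l \<in> integer_lattice" "\<rho> l = w" using w(1) \<rho>(2) by (metis imageE)
  obtain s where s: "l = q + s *\<^sub>R v" using \<rho>(4)[of q l] l(2) qw by auto
  have "(- s + t * N) - (- s) > 1" using tN by simp
  then obtain j where j: "j \<in> \<int>" "- s < j" "j < - s + t * N" by (rule Ints_between)
  define \<sigma> where "\<sigma> = s + j"
  define p where "p = q + \<sigma> *\<^sub>R v"
  have \<sigma>: "0 < \<sigma>" "\<sigma> < t * N" using j by (auto simp: \<sigma>_def)
  have "p = l + j *\<^sub>R v" by (simp add: p_def s \<sigma>_def algebra_simps)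
  then have pI: "p \<in> integer_lattice" using l(1) v j(1) by (auto intro!: integer_lattice_intros)
  have "p \<in> interior P"
  proof (rule interiorI_support[OF P])
    define M where "M = t * N"
    define \<kappa> where "\<kappa> = \<sigma> / M"
    have M: "M > 1" "\<sigma> < M" using \<sigma> tN by (simp_all only: M_def)
    then have "0 \<le> \<kappa>" "\<kappa> \<le> 1" using \<sigma>(1) by (auto simp: \<kappa>_def)
    moreover have "\<sigma> = \<kappa> * M" using M by (simp add: \<kappa>_def)
    then have "p = (1 - \<kappa>) *\<^sub>R q + \<kappa> *\<^sub>R (q + M *\<^sub>R v)"
      by (simp add: p_def algebra_simps)
    ultimately show "p \<in> P" using convexD_alt[OF P(1) q0 q1] by (simp add: M_def)
  next
    fix u assume u: "\<And>y. y \<in> P \<Longrightarrow> u \<bullet> p \<le> u \<bullet> y"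
    have "0 \<le> - \<sigma> * (u \<bullet> v)" using u[OF q0] by (simp add: p_def inner_add_right)
    moreover have "0 \<le> (t * N - \<sigma>) * (u \<bullet> v)"
      using u[OF q1] by (simp add: p_def inner_add_right algebra_simps)
    \<comment> \<open>As \<open>p\<close> lies strictly between two points of \<open>P\<close> along
      \<open>v\<close>, a functional minimal at \<open>p\<close> is constant in this direction,
      hence on the whole fibre over \<open>w\<close>.\<close>
    ultimately have uv: "u \<bullet> v = 0" using \<sigma> by (simp add: zero_le_mult_iff mult_le_0_iff)
    \<comment> \<open>By depth, some segment from \<open>x'\<close> to \<open>y'\<close> in
      \<open>P\<close> meets the line over \<open>w\<close>, where \<open>u\<close> takes its
      minimum over \<open>P\<close>. Since \<open>x'\<close> has positive weight there, the minimum
      is attained at \<open>x'\<close> too, so \<open>u\<close> is constant on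
      \<open>P\<close>.\<close>
    have "u \<bullet> x' = u \<bullet> p" if x': "x' \<in> P" for x'
    proof -
      obtain y' t' where y': "y' \<in> P" "c \<le> t'" "t' \<le> 1" "w = t' *\<^sub>R \<rho> x' + (1 - t') *\<^sub>R \<rho> y'"
        using w(2) x' unfolding deep_def by blast
      have "\<rho> p = \<rho> (t' *\<^sub>R x' + (1 - t') *\<^sub>R y')"
        using qw \<rho>(3) by (simp add: p_def linear_add[OF \<rho>(1)] linear_scale[OF \<rho>(1)] y'(4))
      then obtain s' where "t' *\<^sub>R x' + (1 - t') *\<^sub>R y' = p + s' *\<^sub>R v" using \<rho>(4) by blast
      then have "u \<bullet> (t' *\<^sub>R x' + (1 - t') *\<^sub>R y') = u \<bullet> (p + s' *\<^sub>R v)" by (rule arg_cong)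
      then have "t' * (u \<bullet> x') + (1 - t') * (u \<bullet> y') = u \<bullet> p" by (simp add: inner_add_right uv)
      then have "t' * (u \<bullet> x' - u \<bullet> p) + (1 - t') * (u \<bullet> y' - u \<bullet> p) = 0"
        by (simp add: algebra_simps)
      moreover have "(1 - t') * (u \<bullet> y' - u \<bullet> p) \<ge> 0" using u[OF y'(1)] y'(3) by simp
      moreover have "t' * (u \<bullet> x' - u \<bullet> p) \<ge> 0" using u[OF x'] y'(2) N(3) by simp
      ultimately have "t' * (u \<bullet> x' - u \<bullet> p) = 0" by linarith
      then show ?thesis using y'(2) N(3) by simp
    qed
    then show "u = 0" using P(2) unfolding nondegenerate_def by blast
  qed
  then show ?thesis using pI by blast
qed

theorem theorem1p3:
  shows "finite ({P :: (real^3) set. lattice_polytope P \<and> aff_dim P = 3 \<and>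
            interior P \<inter> integer_lattice = {} \<and>
            \<not> cayley_polytope P \<and>
            \<not> projects_to P double_unimodular_2_simplex}
          // {(P, Q). P \<cong>\<^sub>\<int> Q})"
    (is "finite (?E // ?R)")
proof -
  obtain c where c: "c > 0" "\<And>Q :: (real^2) set. lattice_polytope Q \<Longrightarrow> nondegenerate Q \<Longrightarrow>
    width_one Q \<or> Q \<cong>\<^sub>\<int> double_unimodular_2_simplex \<or> (\<exists>w\<in>integer_lattice. deep c w Q)"
    using polygon_trichotomy by blast
  \<comment> \<open>The summand 1 makes \<open>c * N > 1\<close> strict: a fibre longer than one has
    a lattice point strictly between its ends.\<close>
  define N where "N = nat \<lceil>1 / c\<rceil> + 1"
  have N: "N > 0" "c * real N > 1"
  proof -
    have "1 / c < real N" unfolding N_def by linarith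
    then show "c * real N > 1" using c(1) by (simp add: field_simps)
  qed (simp add: N_def)
  have "?E \<subseteq> {P. lattice_polytope P \<and> nondegenerate P \<and> \<not> long_segment (real N) P}"
  proof
    fix P assume "P \<in> ?E"
    then have P: "lattice_polytope P" and dim: "aff_dim P = 3" and hollow: "interior P \<inter> integer_lattice = {}"
      and nc: "\<not> cayley_polytope P" and np: "\<not> projects_to P double_unimodular_2_simplex"
      by auto
    have nd: "nondegenerate P"
      unfolding nondegenerate_def
    proof (intro allI impI, rule ccontr)
      fix u d assume "\<forall>x\<in>P. u \<bullet> x = d" "u \<noteq> 0"
      then have "aff_dim P \<le> aff_dim {x. u \<bullet> x = d}" by (intro aff_dim_subset) auto
      then show False using dim aff_dim_hyperplane[OF \<open>u \<noteq> 0\<close>, of d] by simp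
    qed
    have "\<not> long_segment (real N) P"
    proof
      assume "long_segment (real N) P"
      then obtain x v where x: "x \<in> P" "x + real N *\<^sub>R v \<in> P" and v: "v \<in> integer_lattice" "v \<noteq> 0"
        unfolding long_segment_def by blast
      obtain \<rho> :: "real^3 \<Rightarrow> real^2" where \<rho>: "linear \<rho>" "\<rho> ` integer_lattice = integer_lattice" "surj \<rho>"
        "\<rho> v = 0" "\<And>x y. \<rho> x = \<rho> y \<Longrightarrow> \<exists>s. y = x + s *\<^sub>R v"
        using lattice_projection[OF v] by blast
      have "lattice_polytope ((\<lambda>x. \<rho> x + 0) ` P)"
        using P \<rho>(1) integer_lattice_0
        by (rule lattice_polytope_affine_image) (use \<rho>(2) in blast)
      moreover have "nondegenerate ((\<lambda>x. \<rho> x + 0) ` P)"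
        using nd \<rho>(1,3) by (rule nondegenerate_affine_image)
      ultimately consider "width_one (\<rho> ` P)" | "\<rho> ` P \<cong>\<^sub>\<int> double_unimodular_2_simplex"
        | w where "w \<in> integer_lattice" "deep c w (\<rho> ` P)"
        using c(2)[of "\<rho> ` P"] by auto
      then show False
      proof cases
        case 1
        then have "width_one P" using width_one_pullback[of \<rho> 0 P] \<rho>(1,2) integer_lattice_0 by simp
        then show False using width_one_imp_cayley[OF P nd] nc by blast
      next
        case 2
        then obtain f where f: "affine_unimodular f" "f ` \<rho> ` P = double_unimodular_2_simplex"
          unfolding unimodular_equiv_def by blast
        obtain g b where g: "lattice_aut g" "b \<in> integer_lattice" "f = (\<lambda>x. g x + b)"
          using affine_unimodularE[OF f(1)] .
        have "(f \<circ> \<rho>) ` integer_lattice = integer_lattice"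
        proof -
          have "(f \<circ> \<rho>) ` integer_lattice = (+) b ` g ` \<rho> ` integer_lattice"
            by (auto simp: g(3) image_image add.commute)
          also have "\<dots> = (+) b ` integer_lattice" by (simp add: \<rho>(2) lattice_autD(5)[OF g(1)])
          also have "\<dots> = integer_lattice"
          proof (intro equalityI subsetI)
            fix y :: "real^2" assume "y \<in> integer_lattice"
            then show "y \<in> (+) b ` integer_lattice"
              using integer_lattice_diff[of y b] g(2) by (intro image_eqI[of _ _ "y - b"]) auto
          qed (use g(2) in \<open>auto intro: integer_lattice_add\<close>)
          finally show ?thesis .
        qed
        moreover have "(f \<circ> \<rho>) ` P = double_unimodular_2_simplex" using f(2) by (simp add: image_comp)
        moreover have "linear (g \<circ> \<rho>)" using \<rho>(1) lattice_autD(1)[OF g(1)] by (rule linear_compose)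
        moreover have "f \<circ> \<rho> = (\<lambda>x. (g \<circ> \<rho>) x + b)" by (simp add: g(3) o_def)
        ultimately have "projects_to P double_unimodular_2_simplex"
          unfolding projects_to_def by blast
        then show False using np by blast
      next
        case 3
        then show False
          using deep_projection_imp_interior_lattice_point[OF lattice_polytopeD(1)[OF P] nd \<rho>(1,2,4,5) v(1) x]
            N c(1) hollow by simp
      qed
    qed
    then show "P \<in> {P. lattice_polytope P \<and> nondegenerate P \<and> \<not> long_segment (real N) P}"
      using P nd by blast
  qed
  \<comment> \<open>The classes are taken among all sets, so fewer polytopes just give fewer
    classes.\<close>
  then have "?E // ?R \<subseteq> {P. lattice_polytope P \<and> nondegenerate P \<and> \<not> long_segment (real N) P} // ?R"
    unfolding quotient_def by (intro UN_mono) auto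
  then show ?thesis using finite_classes_no_long_segment[OF N(1)] by (rule finite_subset)
qed

end
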